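(* Let $G_1,G_2$ be finite groups. Then the power graphs $\mathcal P_{G_1}$ and $\mathcal P_{G_2}$ are isomorphic if and only if there is an isomorphism $\sigma$ from the poset $(\mathcal C(G_1),\subseteq)$ to the poset $(\mathcal C(G_2),\subseteq)$ such that $|\sigma(C)|=|C|$ for every $C\in\mathcal C(G_1)$.
   Context: The power graph $\mathcal P_G$ of a finite group $G$ has vertex set $G$, two distinct elements adjacent iff one is a power of the other. $\mathcal C(G)$ denotes the set of all cyclic subgroups of $G$, partially ordered by inclusion. *)

theory Defs
  imports
    "HOL-Algebra.Elementary_Groups"
    "Graph_Theory.Graph_Theory"
begin

text \<open>Undirected simple graphs are represented as symmetric loop-free digraphs
  (locale \<^locale>\<open>pair_graph\<close>), so each edge contributes both of its arcs.\<close>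

definition power_graph :: "('a, 'm) monoid_scheme \<Rightarrow> 'a pair_pre_digraph" where
  "power_graph G = \<lparr>
     pverts = carrier G,
     parcs = {(x, y). x \<in> carrier G \<and> y \<in> carrier G \<and> x \<noteq> y \<and>
       ((\<exists>n::int. y = x [^]\<^bsub>G\<^esub> n) \<or> (\<exists>n::int. x = y [^]\<^bsub>G\<^esub> n))} \<rparr>"

lemma pair_graph_power_graph:
  assumes "finite (carrier G)"
  shows "pair_graph (power_graph G)"
proof
  have "parcs (power_graph G) \<subseteq> carrier G \<times> carrier G"
    by (auto simp: power_graph_def)
  then show "finite (parcs (power_graph G))"
    by (rule finite_subset) (simp add: assms)
qed (use assms in \<open>auto simp: power_graph_def symmetric_def sym_def\<close>)

definition cyclic_subgroups :: "('a, 'm) monoid_scheme \<Rightarrow> 'a set set" where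
  "cyclic_subgroups G = {C. subgroup C G \<and> cyclic_group (G\<lparr>carrier := C\<rparr>)}"

definition poset_isomorphism :: "'a set set \<Rightarrow> 'b set set \<Rightarrow> ('a set \<Rightarrow> 'b set) \<Rightarrow> bool" where
  "poset_isomorphism P Q \<sigma> \<longleftrightarrow>
     bij_betw \<sigma> P Q \<and> (\<forall>A\<in>P. \<forall>B\<in>P. A \<subseteq> B \<longleftrightarrow> \<sigma> A \<subseteq> \<sigma> B)"

end

theory Submission
  imports
    Defs
    "HOL-Number_Theory.Totient"
    "HOL-Algebra.Multiplicative_Group"
    "HOL-Algebra.Sylow"
begin

text \<open>
  A poset isomorphism that preserves cardinalities matches generators with generators, since a cyclic
  group of order \<open>n\<close> has \<open>totient n\<close> of them; this gives an isomorphism of power graphs.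

  Conversely, an isomorphism of power graphs need not preserve the preorder given by taking powers, so it
  is rearranged inside the classes of vertices with equal closed neighbourhoods (twins).
  Unless some vertex adjacent to all others has an order that is not a prime power, the direction of
  every comparable pair of non-twins can be read off the graph. The elements below the top of a twin
  class \<open>X\<close> are those of \<open>X\<close> and the non-twins below \<open>X\<close>, so their number, the order of the
  top, is determined by the graph, and by induction on the order so is the multiset of orders occurring
  in \<open>X\<close>. Any bijection that matches these orders class by class preserves the preorder.
  In the exceptional case the group is cyclic, and by Cauchy's theorem so is the other one.
\<close>

section \<open>Arithmetic and counting\<close>

lemma power_of_prime_if_unique_prime_factor:
  fixes n p :: nat
  assumes "n > 0" and "\<And>q. prime q \<Longrightarrow> q dvd n \<Longrightarrow> q = p"
  shows "\<exists>k. n = p ^ k"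
proof -
  have "prime_factors n \<subseteq> {p}"
    using assms(2) by (auto simp: in_prime_factors_iff)
  then have "prime_factorization n = replicate_mset (size (prime_factorization n)) p"
    by (rule set_mset_subset_singletonD)
  then have "n = prod_mset (replicate_mset (size (prime_factorization n)) p)"
    using prod_mset_prime_factorization_nat[OF assms(1)] by metis
  then show ?thesis by (metis prod_mset_replicate_mset)
qed

text \<open>Some prime \<open>q\<close> occurs in \<open>n\<close> more often than in
  \<open>m\<close>. Its full power in \<open>n\<close> cannot divide \<open>m\<close>, hence is a
  multiple of \<open>m\<close>, so \<open>m\<close> is a power of \<open>q\<close>; a second prime
  divisor of \<open>n\<close> would be incomparable with \<open>m\<close>.\<close>

lemma prime_power_if_middle_divisor:
  fixes m n :: nat
  assumes "n > 0" "m > 1" "m dvd n" "m \<noteq> n"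
    and comparable: "\<And>d. d dvd n \<Longrightarrow> d dvd m \<or> m dvd d"
  shows "\<exists>p k. prime p \<and> n = p ^ k"
proof -
  have "\<not> n dvd m" using assms(3,4) dvd_antisym by blast
  then obtain q where q: "prime q" "\<not> multiplicity q n \<le> multiplicity q m"
    using multiplicity_le_imp_dvd[of n m] assms(1) by auto
  let ?d = "q ^ multiplicity q n"
  have "\<not> ?d dvd m"
    using q assms(2) by (subst power_dvd_iff_le_multiplicity) auto
  moreover have "?d dvd n" by (rule multiplicity_dvd)
  ultimately have "m dvd ?d" using comparable by blast
  then obtain j where j: "m = q ^ j" using q(1) divides_primepow_nat by blast
  have "r = q" if r: "prime r" "r dvd n" for r
    using comparable[OF r(2)] r(1) q(1) j assms(2)
    by (metis less_irrefl prime_dvd_power_nat prime_nat_iff primes_dvd_imp_eq)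
  then show ?thesis
    using power_of_prime_if_unique_prime_factor[OF assms(1)] q(1) by blast
qed

text \<open>A relative form, for divisors between \<open>a\<close> and \<open>c\<close>: if a prime
  \<open>q\<close> other than \<open>p\<close> divided \<open>c\<close>, then \<open>a * q\<close>
  would be such a divisor and incomparable with \<open>b\<close>.\<close>

lemma power_of_prime_if_middle_divisor:
  fixes a b c p :: nat
  assumes "c > 0" "prime p" "b = p ^ k" "a dvd b" "b dvd c" "a > 1" "a \<noteq> b"
    and comparable: "\<And>d. a dvd d \<Longrightarrow> d dvd c \<Longrightarrow> d dvd b \<or> b dvd d"
  shows "\<exists>j. c = p ^ j"
proof (rule power_of_prime_if_unique_prime_factor[OF assms(1)], rule ccontr)
  fix q :: nat assume q: "prime q" "q dvd c" "q \<noteq> p"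
  then have cop: "coprime q b" using assms(2,3)
    by (simp add: primes_coprime)
  then have copa: "coprime q a" using assms(4) by (metis coprime_divisors dvd_refl)
  have "a * q dvd c"
    using copa q(2) assms(4,5) by (meson coprime_commute divides_mult dvd_trans)
  then have "a * q dvd b \<or> b dvd a * q" using comparable by simp
  then show False
  proof
    assume "a * q dvd b"
    then have "q dvd b" by (rule dvd_mult_right)
    then show False using cop q(1) by (metis coprime_absorb_left not_prime_unit)
  next
    assume "b dvd a * q"
    then have "b dvd a" using cop by (simp add: coprime_commute coprime_dvd_mult_left_iff)
    then show False using assms(4,7) dvd_antisym by blast
  qed
qed

section \<open>Ties between totients, and matching by counts\<close>

text \<open>Multiplying by \<open>p\<close> scales the totient by \<open>p\<close> if
  \<open>p\<close> divides \<open>m\<close> and by \<open>p - 1\<close> otherwise; only the factor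
  \<open>2 - 1\<close> fails to increase it.\<close>

lemma totient_mult_prime_le:
  fixes m p :: nat
  assumes "m > 0" "prime p" "totient (m * p) \<le> totient m"
  shows "p = 2 \<and> odd m"
proof (cases "p dvd m")
  case True
  then have "totient (m * p) * totient p = totient m * totient p * p"
    using totient_gcd[of m p] by (simp add: gcd_nat.absorb2)
  then have "totient (m * p) = totient m * p" using assms(2) by (simp add: prime_gt_0_nat)
  then show ?thesis using assms prime_gt_1_nat[of p] by simp
next
  case False
  then have cop: "coprime m p" using assms(2) by (metis coprime_commute prime_imp_coprime)
  then have "totient m * (p - 1) \<le> totient m"
    using assms(2,3) by (simp add: totient_mult_coprime totient_prime)
  then have "p \<le> 2" using assms(1) by simp
  then have "p = 2" using prime_ge_2_nat[OF assms(2)] by simp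
  then show ?thesis using False by simp
qed


text \<open>Totients never decrease along divisibility, so every prime step from \<open>m\<close>
  towards \<open>n\<close> is a tie. The first step must be by 2 from an odd \<open>m\<close>; a
  second one would start from the even number \<open>2 * m\<close>.\<close>

lemma totient_eq_if_dvd:
  fixes m n :: nat
  assumes "m dvd n" "m \<noteq> n" "n > 0" "totient m = totient n"
  shows "n = 2 * m \<and> odd m"
proof -
  obtain k where k: "n = m * k" using assms(1) by blast
  have m: "m > 0" "k > 0" using assms(3) k by auto
  have step: "p = 2 \<and> odd m'" if "prime p" "m' > 0" "m' * p dvd n" "totient m' = totient n" for p m'
    using totient_mult_prime_le[OF that(2,1)] totient_dvd_mono[OF that(3) assms(3)] that(4) by simp
  have "k \<noteq> 1" using k assms(2) by auto
  then obtain p where p: "prime p" "p dvd k" using prime_factor_nat by blast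
  then have odd: "p = 2" "odd m" using step[OF p(1) m(1)] assms(4) k by simp_all
  obtain k' where k': "k = 2 * k'" using p odd by blast
  have "k' = 1"
  proof (rule ccontr)
    assume "k' \<noteq> 1"
    then obtain q where q: "prime q" "q dvd k'" using prime_factor_nat by blast
    have "totient (2 * m) = totient n" using odd assms(4) by (simp add: totient_double)
    moreover have "2 * m * q dvd n" using k k' q by simp
    ultimately show False using step[OF q(1), of "2 * m"] m by simp
  qed
  then show ?thesis using k k' odd by simp
qed

text \<open>Glues bijections between equally labelled fibres. The labels used later are closed
  neighbourhood together with order, order alone, and cyclic subgroup.\<close>

lemma bij_betw_if_card_fibres_eq:
  assumes "finite A" "finite B"
    and fibres: "\<And>k. card {x \<in> A. g x = k} = card {y \<in> B. h y = k}"
  shows "\<exists>F. bij_betw F A B \<and> (\<forall>x\<in>A. h (F x) = g x)"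
proof -
  have "\<exists>F. bij_betw F {x \<in> A. g x = k} {y \<in> B. h y = k}" for k
    using assms by (intro finite_same_card_bij) auto
  then obtain F where F: "\<And>k. bij_betw (F k) {x \<in> A. g x = k} {y \<in> B. h y = k}"
    by metis
  have mem: "F (g x) x \<in> B \<and> h (F (g x) x) = g x" if "x \<in> A" for x
    using bij_betw_apply[OF F[of "g x"], of x] that by auto
  have "bij_betw (\<lambda>x. F (g x) x) A B"
  proof (rule bij_betw_imageI)
    show "inj_on (\<lambda>x. F (g x) x) A"
    proof (rule inj_onI)
      fix x y assume xy: "x \<in> A" "y \<in> A" "F (g x) x = F (g y) y"
      then have "g x = g y" using mem by metis
      then show "x = y" using xy F[of "g y"] by (auto simp: bij_betw_def dest: inj_onD)
    qed
    have "\<exists>x\<in>A. y = F (g x) x" if "y \<in> B" for y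
    proof -
      have "y \<in> F (h y) ` {x \<in> A. g x = h y}"
        using F[of "h y"] that by (simp add: bij_betw_def)
      then show ?thesis by force
    qed
    then show "(\<lambda>x. F (g x) x) ` A = B" using mem by auto
  qed
  then show ?thesis using mem by blast
qed

section \<open>Twin classes in the preorder of powers\<close>

text \<open>The closed neighbourhood of \<open>x\<close> in the comparability graph of
  \<open>r\<close>; reflexivity of \<open>r\<close> puts \<open>x\<close> itself into it.\<close>

definition nbhd :: "'a set \<Rightarrow> ('a \<Rightarrow> 'a \<Rightarrow> bool) \<Rightarrow> 'a \<Rightarrow> 'a set" where
  "nbhd V r x = {y \<in> V. r x y \<or> r y x}"

definition twins :: "'a set \<Rightarrow> ('a \<Rightarrow> 'a \<Rightarrow> bool) \<Rightarrow> 'a \<Rightarrow> 'a set" where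
  "twins V r x = {y \<in> V. nbhd V r y = nbhd V r x}"

text \<open>
  Strict comparability of non-twins, expressed through closed neighbourhoods alone. The twin
  classes of elements of orders \<open>m dvd n\<close> have sizes \<open>totient m \<le> totient n\<close> in the generic case,
  and the sizes tie only for \<open>n = 2 * m\<close> with \<open>m\<close> odd; then the witness \<open>u\<close> is the involution below
  the larger element.
\<close>

definition graph_less :: "'a set \<Rightarrow> ('a \<Rightarrow> 'a \<Rightarrow> bool) \<Rightarrow> 'a \<Rightarrow> 'a \<Rightarrow> bool" where
  "graph_less V r x y \<longleftrightarrow> y \<in> nbhd V r x \<and> nbhd V r x \<noteq> nbhd V r y \<and>
    (nbhd V r x = V \<or>
     nbhd V r x \<noteq> V \<and> nbhd V r y \<noteq> V \<and>
       (card (twins V r x) < card (twins V r y) \<or>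
        card (twins V r x) = card (twins V r y) \<and>
        (\<exists>u\<in>V. nbhd V r u \<noteq> V \<and> card (twins V r u) = 1 \<and> y \<in> nbhd V r u \<and> x \<notin> nbhd V r u)))"

text \<open>
  The model is a finite group with \<open>le x y\<close> meaning that \<open>x\<close> is a power of \<open>y\<close>, and \<open>deg\<close> the
  order of an element.
\<close>

locale cyclic_preorder =
  fixes V :: "'a set" and le :: "'a \<Rightarrow> 'a \<Rightarrow> bool" and deg :: "'a \<Rightarrow> nat"
  assumes finite_V: "finite V"
    and le_refl: "x \<in> V \<Longrightarrow> le x x"
    and le_trans: "\<lbrakk>x \<in> V; y \<in> V; z \<in> V; le x y; le y z\<rbrakk> \<Longrightarrow> le x z"
    and least: "\<exists>e\<in>V. \<forall>x\<in>V. le e x"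
    and deg_pos: "x \<in> V \<Longrightarrow> deg x > 0"
    and deg_dvd: "\<lbrakk>x \<in> V; y \<in> V; le x y\<rbrakk> \<Longrightarrow> deg x dvd deg y"
    and le_if_deg_dvd: "\<lbrakk>x \<in> V; y \<in> V; z \<in> V; le x z; le y z; deg x dvd deg y\<rbrakk> \<Longrightarrow> le x y"
    and card_deg_eq: "\<lbrakk>x \<in> V; d dvd deg x\<rbrakk> \<Longrightarrow> card {y \<in> V. le y x \<and> deg y = d} = totient d"
    and cauchy: "\<lbrakk>prime p; p dvd card V\<rbrakk> \<Longrightarrow> \<exists>x\<in>V. deg x = p"
begin

abbreviation N where "N \<equiv> nbhd V le"
abbreviation T where "T \<equiv> twins V le"

lemma nbhd_iff: "y \<in> N x \<longleftrightarrow> y \<in> V \<and> (le x y \<or> le y x)"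
  by (simp add: nbhd_def)

lemma nbhd_sym: "x \<in> V \<Longrightarrow> y \<in> N x \<Longrightarrow> x \<in> N y"
  by (auto simp: nbhd_def)

lemma twins_iff: "y \<in> T x \<longleftrightarrow> y \<in> V \<and> N y = N x"
  by (simp add: twins_def)

lemma finite_twins: "finite (T x)"
  using finite_V by (simp add: twins_def)

section \<open>Orders and the elements below a given one\<close>

lemma ex_deg_eq:
  assumes "x \<in> V" "d dvd deg x"
  obtains z where "z \<in> V" "le z x" "deg z = d"
proof -
  have "d > 0" using assms deg_pos dvd_pos_nat by blast
  then have "card {y \<in> V. le y x \<and> deg y = d} > 0" using card_deg_eq[OF assms] by simp
  then have "{y \<in> V. le y x \<and> deg y = d} \<noteq> {}" by (metis card.empty less_irrefl)
  then show thesis using that by auto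
qed

text \<open>The elements below \<open>x\<close> are sorted by order, and the totients of the
  divisors of a number add up to it (Gauss). Thus an order can be recovered from the size of a
  down-set.\<close>

lemma card_down:
  assumes "x \<in> V"
  shows "card {y \<in> V. le y x} = deg x"
proof -
  have "{y \<in> V. le y x} = (\<Union>d\<in>{d. d dvd deg x}. {y \<in> V. le y x \<and> deg y = d})"
    using assms deg_dvd by auto
  also have "card \<dots> = (\<Sum>d | d dvd deg x. card {y \<in> V. le y x \<and> deg y = d})"
    using finite_V deg_pos[OF assms] by (intro card_UN_disjoint) auto
  also have "\<dots> = (\<Sum>d | d dvd deg x. totient d)"
    using card_deg_eq[OF assms] by simp
  finally show ?thesis by (simp add: totient_divisor_sum)
qed

lemma le_if_deg_eq_1:
  assumes "x \<in> V" "w \<in> V" "deg x = 1"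
  shows "le x w"
proof -
  obtain e where e: "e \<in> V" "\<forall>x\<in>V. le e x" using least by blast
  then have "le x e" using le_if_deg_dvd[of x e x] assms le_refl by simp
  then show ?thesis using e assms le_trans by blast
qed

lemma nbhd_if_deg_eq_1: "x \<in> V \<Longrightarrow> deg x = 1 \<Longrightarrow> N x = V"
  using le_if_deg_eq_1 by (auto simp: nbhd_def)

lemma nbhd_eq_if_le_le:
  assumes "x \<in> V" "y \<in> V" "le x y" "le y x"
  shows "N x = N y"
  using assms le_trans unfolding nbhd_def by blast

lemma self_nbhd: "x \<in> V \<Longrightarrow> x \<in> N x"
  using le_refl by (simp add: nbhd_def)

text \<open>Orders divide along the preorder, so for a comparable pair they settle the direction.
  Hence a graph isomorphism that keeps orders also keeps directions.\<close>

lemma le_if_comparable_deg_le: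
  assumes "x \<in> V" "y \<in> V" "le x y \<or> le y x" "deg x \<le> deg y"
  shows "le x y"
proof (cases "le x y")
  case False
  then have yx: "le y x" using assms by blast
  then have "deg y dvd deg x" using deg_dvd assms by blast
  then have "deg x = deg y" using assms deg_pos[of x] by (meson dvd_imp_le le_antisym)
  then show ?thesis using le_if_deg_dvd[of x y x] assms yx le_refl by simp
qed

lemma card_generators:
  "x \<in> V \<Longrightarrow> card {y \<in> V. le y x \<and> deg y = deg x} = totient (deg x)"
  using card_deg_eq by simp

lemma generators_subset_twins:
  assumes "x \<in> V"
  shows "{y \<in> V. le y x \<and> deg y = deg x} \<subseteq> T x"
proof
  fix y assume y: "y \<in> {y \<in> V. le y x \<and> deg y = deg x}"
  then have "le x y" using assms le_if_comparable_deg_le[of x y] by simp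
  then have "N y = N x" using y assms nbhd_eq_if_le_le[of y x] by simp
  then show "y \<in> T x" using y by (simp add: twins_iff)
qed

lemma totient_le_card_twins: "x \<in> V \<Longrightarrow> totient (deg x) \<le> card (T x)"
  using card_mono[OF finite_twins generators_subset_twins] card_generators by metis

section \<open>Twins of different orders force prime powers\<close>

text \<open>Every divisor of \<open>deg y\<close> is the order of something below \<open>y\<close>,
  which is comparable with the twin \<open>x\<close>. So \<open>deg x\<close> is a proper divisor
  comparable with all divisors of \<open>deg y\<close>.\<close>

lemma prime_power_if_twins:
  assumes "x \<in> V" "y \<in> V" "le x y" "N x = N y" "deg x \<noteq> deg y" "deg x \<noteq> 1"
  shows "\<exists>p k. prime p \<and> deg y = p ^ k"
proof (rule prime_power_if_middle_divisor)
  show "deg y > 0" "deg x dvd deg y" "deg x \<noteq> deg y"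
    using assms deg_pos deg_dvd by auto
  show "deg x > 1" using assms deg_pos[of x] by simp
  fix d assume "d dvd deg y"
  then obtain z where z: "z \<in> V" "le z y" "deg z = d" using ex_deg_eq assms(2) by blast
  then have "z \<in> N x" using assms(4) by (simp add: nbhd_iff)
  then show "d dvd deg x \<or> deg x dvd d" using z assms(1) deg_dvd by (auto simp: nbhd_iff)
qed

text \<open>Clear if \<open>w\<close> is below \<open>y\<close>. Otherwise the elements between
  \<open>x\<close> and \<open>w\<close> realise all orders between theirs and are comparable with
  \<open>y\<close>, being neighbours of its twin \<open>x\<close>; the relative divisor criterion
  applies.\<close>

lemma power_if_above_twins:
  assumes xy: "x \<in> V" "y \<in> V" "le x y" "N x = N y" "deg x \<noteq> deg y" "deg x \<noteq> 1"
    and p: "prime p" "deg y = p ^ k" and w: "w \<in> V" "le x w"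
  shows "\<exists>j. deg w = p ^ j"
proof -
  have "w \<in> N y" using w xy(4) nbhd_iff by auto
  then consider "le w y" | "le y w" by (auto simp: nbhd_iff)
  then show ?thesis
  proof cases
    case 1
    then have "deg w dvd p ^ k" using deg_dvd w xy(2) p(2) by metis
    then show ?thesis using divides_primepow_nat[OF p(1)] by blast
  next
    case 2
    show ?thesis
    proof (rule power_of_prime_if_middle_divisor)
      show "prime p" "deg y = p ^ k" "deg w > 0" "deg x dvd deg y" "deg y dvd deg w" "deg x \<noteq> deg y"
        using p xy w(1) deg_pos[of w] deg_dvd[OF xy(1-3)] deg_dvd[OF xy(2) w(1) 2] by simp_all
      show "deg x > 1" using xy deg_pos[of x] by simp
      fix d assume d: "deg x dvd d" "d dvd deg w"
      then obtain z where z: "z \<in> V" "le z w" "deg z = d" using ex_deg_eq w(1) by blast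
      then have "le x z" using le_if_deg_dvd d w xy(1) by blast
      then have "z \<in> N y" using z xy(4) nbhd_iff by auto
      then show "d dvd deg y \<or> deg y dvd d" using z xy(2) deg_dvd by (auto simp: nbhd_iff)
    qed
  qed
qed

text \<open>Powers of one prime form a chain under divisibility, and below a common \<open>t\<close>
  divisibility of orders decides the preorder.\<close>

lemma comparable_if_prime_power:
  assumes "x \<in> V" "y \<in> V" "t \<in> V" "le x t" "le y t" "prime p" "deg t = p ^ k"
  shows "le x y \<or> le y x"
proof -
  have "deg x dvd p ^ k" "deg y dvd p ^ k" using assms deg_dvd by metis+
  then obtain i j where "deg x = p ^ i" "deg y = p ^ j"
    using divides_primepow_nat[OF \<open>prime p\<close>] by blast
  then have "deg x dvd deg y \<or> deg y dvd deg x"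
    by (metis le_imp_power_dvd nat_le_linear)
  then show ?thesis using le_if_deg_dvd assms by blast
qed

text \<open>Neighbours of the twins \<open>x\<close> and \<open>t\<close> are comparable with
  \<open>y\<close> by transitivity, except those merely known to lie below \<open>t\<close>; there
  the prime-power order of \<open>t\<close> takes over.\<close>

lemma nbhd_convex:
  assumes "x \<in> V" "y \<in> V" "t \<in> V" "N x = N t" "le x y" "le y t" "prime p" "deg t = p ^ k"
  shows "N y = N x"
proof
  show "N y \<subseteq> N x"
  proof
    fix w assume "w \<in> N y"
    then have "w \<in> V" "le y w \<or> le w y" by (auto simp: nbhd_iff)
    then have "w \<in> N x \<or> w \<in> N t" using assms le_trans unfolding nbhd_iff by blast
    then show "w \<in> N x" using assms(4) by simp
  qed
  show "N x \<subseteq> N y"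
  proof
    fix w assume w: "w \<in> N x"
    then have V: "w \<in> V" and "le x w \<or> le w x" "le t w \<or> le w t"
      using assms(4) by (auto simp: nbhd_iff)
    then consider "le w x" | "le t w" | "le w t" by blast
    then have "le y w \<or> le w y"
    proof cases
      case 3
      then show ?thesis using comparable_if_prime_power[of w y t] assms V by blast
    qed (use assms V le_trans in blast)+
    then show "w \<in> N y" using V by (simp add: nbhd_iff)
  qed
qed

lemma twins_refl: "x \<in> V \<Longrightarrow> x \<in> T x"
  by (simp add: twins_iff)

lemma twins_comparable:
  assumes "x \<in> V" "y \<in> T x" "z \<in> T x"
  shows "le y z \<or> le z y"
proof -
  have "z \<in> N y" using assms self_nbhd[of z] by (simp add: twins_iff)
  then show ?thesis by (simp add: nbhd_iff)
qed

lemma twins_top: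
  assumes "x \<in> V"
  obtains t where "t \<in> T x" "\<And>y. y \<in> T x \<Longrightarrow> le y t"
proof -
  have "finite (deg ` T x)" "deg ` T x \<noteq> {}" using finite_twins twins_refl[OF assms] by auto
  then obtain t where t: "t \<in> T x" "deg t = Max (deg ` T x)"
    using Max_in by (metis imageE)
  have "le y t" if "y \<in> T x" for y
  proof -
    have "deg y \<le> deg t" using t that finite_twins by simp
    then show ?thesis
      using le_if_comparable_deg_le twins_comparable[OF assms that t(1)] that t(1) twins_iff by blast
  qed
  then show thesis using that t by blast
qed

section \<open>Sizes of twin classes\<close>

text \<open>In a pure class, one with a single order, mutual comparability puts all members below
  \<open>x\<close>; the class is the set of generators of one cyclic group.\<close>

lemma card_twins_if_pure:
  assumes "x \<in> V" "\<forall>y\<in>T x. deg y = deg x"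
  shows "card (T x) = totient (deg x)"
proof -
  have "le y x" if y: "y \<in> T x" for y
  proof (rule le_if_comparable_deg_le)
    show "y \<in> V" "x \<in> V" using y assms(1) by (auto simp: twins_def)
    show "le y x \<or> le x y" using twins_comparable[OF assms(1) y twins_refl[OF assms(1)]] .
    show "deg y \<le> deg x" using assms(2) y by simp
  qed
  then have "T x \<subseteq> {y \<in> V. le y x \<and> deg y = deg x}"
    using assms(2) by (auto simp: twins_iff)
  then have "T x = {y \<in> V. le y x \<and> deg y = deg x}"
    using generators_subset_twins[OF assms(1)] by blast
  then show ?thesis using card_generators[OF assms(1)] by simp
qed

lemma impure_twins:
  assumes "x \<in> V" "\<exists>y\<in>T x. deg y \<noteq> deg x"
  obtains t b where "t \<in> T x" "\<And>y. y \<in> T x \<Longrightarrow> le y t" "b \<in> T x" "deg b \<noteq> deg t"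
proof -
  obtain t where t: "t \<in> T x" "\<And>y. y \<in> T x \<Longrightarrow> le y t" using twins_top assms(1) by blast
  obtain y where "y \<in> T x" "deg y \<noteq> deg x" using assms by blast
  then have "\<exists>b\<in>T x. deg b \<noteq> deg t" using twins_refl[OF assms(1)] by metis
  then show thesis using that t by blast
qed

text \<open>Impurity brings in a prime \<open>p\<close>: the top \<open>t\<close> of the class has
  order \<open>p ^ k\<close> and \<open>y\<close> has order \<open>p ^ j\<close> with
  \<open>k < j\<close>. The class is smaller than \<open>deg t\<close>, while that of
  \<open>y\<close> has at least \<open>totient (deg y)\<close> members.\<close>

lemma card_twins_less_if_impure_below:
  assumes "x \<in> V" "y \<in> V" "le x y" "N x \<noteq> N y" "N x \<noteq> V" "\<exists>z\<in>T x. deg z \<noteq> deg x"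
  shows "card (T x) < card (T y)"
proof -
  obtain t b where t: "t \<in> T x" "\<And>y. y \<in> T x \<Longrightarrow> le y t" and b: "b \<in> T x" "deg b \<noteq> deg t"
    using impure_twins assms(1,6) by blast
  have V: "t \<in> V" "b \<in> V" "N t = N x" "N b = N x" using t b by (auto simp: twins_iff)
  have b1: "deg b \<noteq> 1" using nbhd_if_deg_eq_1 V assms(5) by metis
  obtain p k where p: "prime p" "deg t = p ^ k"
    using prime_power_if_twins[of b t] V t(2)[OF b(1)] b b1 by auto
  \<comment> \<open>By convexity, \<open>y\<close> below \<open>t\<close> would be a twin of
    \<open>x\<close>.\<close>
  have nyt: "\<not> le y t"
    using nbhd_convex[of x y t, OF _ _ _ _ _ _ p] assms V by metis
  have "y \<in> N x" using assms by (simp add: nbhd_iff)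
  then have "y \<in> N b" "y \<in> N t" using V by auto
  then have "le b y" "le t y" using nyt le_trans V t(2)[OF b(1)] assms(2) unfolding nbhd_iff by blast+
  obtain j where j: "deg y = p ^ j"
    using power_if_above_twins[of b t p k y] V t(2)[OF b(1)] b b1 p assms(2) \<open>le b y\<close> by auto
  have "deg t dvd deg y" using deg_dvd V assms(2) \<open>le t y\<close> by blast
  moreover have "deg t \<noteq> deg y"
    using nyt le_if_comparable_deg_le[of y t] V assms(2) \<open>le t y\<close> by auto
  ultimately have "deg t < deg y" using deg_pos[OF assms(2)] by (simp add: dvd_imp_le le_neq_implies_less)
  then have kj: "k < j" using p j prime_gt_1_nat by (metis power_strict_increasing_iff)
  \<comment> \<open>The element of order 1 is adjacent to everything, so it lies below
    \<open>t\<close> but outside the class; this makes the bound by \<open>deg t\<close>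
    strict.\<close>
  obtain u where u: "u \<in> V" "le u t" "deg u = 1" using ex_deg_eq[OF V(1), of 1] by auto
  have "u \<notin> T x" using nbhd_if_deg_eq_1[OF u(1,3)] assms(5) by (simp add: twins_iff)
  moreover have "T x \<subseteq> {z \<in> V. le z t}" using t(2) by (auto simp: twins_iff)
  ultimately have "T x \<subset> {z \<in> V. le z t}" using u(1,2) by blast
  then have "card (T x) < deg t"
    using card_down[OF V(1)] psubset_card_mono[of "{z \<in> V. le z t}" "T x"] finite_V by simp
  also have "deg t \<le> p ^ (j - 1) * (p - 1)"
  proof -
    have "p ^ k \<le> p ^ (j - 1)" using kj prime_gt_0_nat[OF p(1)] by (intro power_increasing) auto
    moreover have "1 \<le> p - 1" using prime_gt_1_nat[OF p(1)] by simp
    ultimately show ?thesis using p(2) by (metis mult.right_neutral mult_le_mono)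
  qed
  also have "\<dots> = totient (deg y)" using j kj p(1) by (simp add: totient_prime_power)
  also have "\<dots> \<le> card (T y)" by (rule totient_le_card_twins[OF assms(2)])
  finally show ?thesis .
qed

text \<open>The pure class of \<open>x\<close> has at most as many members as there are generators
  below the top \<open>t\<close> of the other class; that class contains those generators and also
  \<open>b\<close>.\<close>

lemma card_twins_less_if_impure_above:
  assumes "x \<in> V" "y \<in> V" "le x y" "\<forall>z\<in>T x. deg z = deg x" "\<exists>z\<in>T y. deg z \<noteq> deg y"
  shows "card (T x) < card (T y)"
proof -
  obtain t b where t: "t \<in> T y" "\<And>z. z \<in> T y \<Longrightarrow> le z t" and b: "b \<in> T y" "deg b \<noteq> deg t"
    using impure_twins assms(2,5) by blast
  have V: "t \<in> V" "b \<in> V" and Tt: "T t = T y" using t b by (auto simp: twins_def)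
  have "le x t" using le_trans t(2)[OF twins_refl] assms V by blast
  then have "card (T x) \<le> totient (deg t)"
    using card_twins_if_pure[OF assms(1,4)] totient_dvd_mono deg_dvd deg_pos assms(1) V by simp
  also have "\<dots> = card {z \<in> V. le z t \<and> deg z = deg t}" using card_generators[OF V(1)] by simp
  also have "\<dots> < card (T y)"
  proof (rule psubset_card_mono[OF finite_twins])
    show "{z \<in> V. le z t \<and> deg z = deg t} \<subset> T y"
      using generators_subset_twins[OF V(1)] Tt b by auto
  qed
  finally show ?thesis .
qed

text \<open>With purity on both sides the sizes are totients, whose only ties come from doubling an
  odd number; any impurity gives a strict inequality. Order 1 is excluded by
  \<open>N x \<noteq> V\<close>.\<close>

lemma card_twins_cases:
  assumes "x \<in> V" "y \<in> V" "le x y" "N x \<noteq> N y" "N x \<noteq> V"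
  shows "card (T x) < card (T y) \<or>
    card (T x) = card (T y) \<and> deg y = 2 * deg x \<and> odd (deg x) \<and> deg x \<noteq> 1"
proof (cases "(\<forall>z\<in>T x. deg z = deg x) \<and> (\<forall>z\<in>T y. deg z = deg y)")
  case True
  have dvd: "deg x dvd deg y" "deg y > 0" using assms deg_dvd deg_pos by auto
  have ne: "deg x \<noteq> deg y"
  proof
    assume "deg x = deg y"
    then have "le y x" using le_if_comparable_deg_le[of y x] assms(1-3) by simp
    then show False using nbhd_eq_if_le_le assms(1-4) by blast
  qed
  have "deg x \<noteq> 1" using nbhd_if_deg_eq_1 assms by blast
  moreover have "card (T x) = totient (deg x)" "card (T y) = totient (deg y)"
    using True card_twins_if_pure assms(1,2) by blast+
  ultimately show ?thesis
    using totient_dvd_mono[OF dvd] totient_eq_if_dvd[OF dvd(1) ne dvd(2)]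
    by (metis le_neq_implies_less)
next
  case False
  then have "card (T x) < card (T y)"
    using card_twins_less_if_impure_below[OF assms] card_twins_less_if_impure_above[OF assms(1-3)]
    by fast
  then show ?thesis ..
qed

text \<open>The witness is an element \<open>u\<close> of order 2 below \<open>y\<close>,
  incomparable with \<open>x\<close>, whose order is odd and not 1. A twin of \<open>u\<close> of
  another order would force \<open>deg y\<close>, hence \<open>deg x\<close>, to be a power of
  2.\<close>

lemma involution_twins:
  assumes "x \<in> V" "y \<in> V" "le x y" "deg y = 2 * deg x" "odd (deg x)" "deg x \<noteq> 1"
  shows "\<exists>u\<in>V. N u \<noteq> V \<and> card (T u) = 1 \<and> y \<in> N u \<and> x \<notin> N u"
proof -
  obtain u where u: "u \<in> V" "le u y" "deg u = 2"
    using ex_deg_eq[OF assms(2), of 2] assms(4) by auto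
  have "\<not> deg x dvd 2" using assms(5,6) by (metis even_numeral prime_nat_iff two_is_prime_nat)
  then have xu: "x \<notin> N u" using u assms deg_dvd[of u x] deg_dvd[of x u] by (auto simp: nbhd_iff)
  then have Nu: "N u \<noteq> V" using assms(1) by blast
  have "deg z = deg u" if z: "z \<in> T u" for z
  proof (rule ccontr)
    assume ne: "deg z \<noteq> deg u"
    have zV: "z \<in> V" "N z = N u" using z by (auto simp: twins_iff)
    have "deg z \<noteq> 1" using zV Nu nbhd_if_deg_eq_1 by metis
    have "\<not> le z u"
    proof
      assume "le z u"
      then have "deg z dvd 2" using deg_dvd zV u by metis
      then show False using ne u(3) \<open>deg z \<noteq> 1\<close> by (metis prime_nat_iff two_is_prime_nat)
    qed
    then have uz: "le u z" using twins_comparable[OF u(1) z twins_refl[OF u(1)]] by blast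
    have ne': "deg u \<noteq> deg z" "deg u \<noteq> 1" using ne u by auto
    obtain p k where p: "prime p" "deg z = p ^ k"
      using prime_power_if_twins[OF u(1) zV(1) uz _ ne'] zV by auto
    obtain j where j: "deg y = p ^ j"
      using power_if_above_twins[OF u(1) zV(1) uz _ ne' p assms(2) u(2)] zV by auto
    have "2 dvd p ^ j" using j assms(4) by (metis dvd_triv_left)
    then have "p = 2" using p(1) by (metis prime_dvd_power primes_dvd_imp_eq two_is_prime_nat)
    moreover have "deg x dvd p ^ j" using j assms(4) by (metis dvd_triv_right)
    ultimately obtain i where "deg x = 2 ^ i" using divides_primepow_nat[OF p(1)] by auto
    then show False using assms(5,6) by (cases i) auto
  qed
  then have "card (T u) = 1" using card_twins_if_pure u by simp
  then show ?thesis using u Nu xu assms(2) by (auto simp: nbhd_iff)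
qed

text \<open>A singleton class of a non-dominating \<open>u\<close> forces \<open>deg u = 2\<close>.
  Hence in a tie no witness favours the wrong direction.\<close>

lemma no_involution_twins:
  assumes "x \<in> V" "odd (deg x)" "deg x \<noteq> 1" "u \<in> V" "N u \<noteq> V" "card (T u) = 1"
  shows "x \<notin> N u"
proof
  assume x: "x \<in> N u"
  have "deg u \<noteq> 1" using nbhd_if_deg_eq_1 assms by blast
  moreover have "deg u \<le> 2"
    using totient_gt_1[of "deg u"] totient_le_card_twins[OF assms(4)] assms(6) by linarith
  ultimately have u: "deg u = 2" using deg_pos[OF assms(4)] by simp
  then have "2 dvd deg x \<or> deg x dvd 2" using x deg_dvd assms(1,4) by (metis nbhd_iff)
  then show False using assms(2,3) by (metis even_numeral prime_nat_iff two_is_prime_nat)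
qed

section \<open>Directions and orders read off the graph\<close>

text \<open>On a comparable pair of non-twins \<open>graph_less\<close> holds in the right direction
  and fails in the other, and by its form it relates only such pairs.\<close>

lemma graph_less_iff:
  assumes good: "\<And>z. z \<in> V \<Longrightarrow> N z = V \<Longrightarrow> \<exists>p k. prime p \<and> deg z = p ^ k"
    and "x \<in> V" "y \<in> V"
  shows "graph_less V le x y \<longleftrightarrow> le x y \<and> N x \<noteq> N y"
proof -
  \<comment> \<open>Here \<open>good\<close> enters: if the dominating \<open>a\<close> were above
    \<open>b\<close>, its prime-power order would make everything below \<open>a\<close> comparable
    with \<open>b\<close>, and everything above \<open>a\<close> is above \<open>b\<close>; so
    \<open>b\<close> would dominate too.\<close>
  have dominating: "le a b" if ab: "a \<in> V" "b \<in> V" "N a = V" "N b \<noteq> V" for a b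
  proof (rule ccontr)
    assume "\<not> le a b"
    then have ba: "le b a" using ab by (auto simp: nbhd_def)
    obtain p k where p: "prime p" "deg a = p ^ k" using good ab by blast
    have "w \<in> N b" if w: "w \<in> V" for w
    proof -
      have "le w a \<or> le a w" using w ab(3) nbhd_iff by blast
      then show ?thesis
        using comparable_if_prime_power[OF w ab(2,1) _ ba p] le_trans ba ab w nbhd_iff by blast
    qed
    then show False using ab(4) by (auto simp: nbhd_iff)
  qed
  have less: "graph_less V le a b \<and> \<not> graph_less V le b a"
    if ab: "a \<in> V" "b \<in> V" "le a b" "N a \<noteq> N b" for a b
  proof (cases "N a = V")
    case True
    then show ?thesis using ab unfolding graph_less_def nbhd_iff by blast
  next
    case False
    have Nb: "N b \<noteq> V"
    proof
      assume "N b = V"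
      then have "le b a" using dominating ab False by blast
      then show False using nbhd_eq_if_le_le ab by blast
    qed
    have bNa: "b \<in> N a" using ab by (simp add: nbhd_iff)
    from card_twins_cases[OF ab False] show ?thesis
    proof
      assume "card (T a) < card (T b)"
      then show ?thesis using False Nb ab bNa by (auto simp: graph_less_def)
    next
      assume eq: "card (T a) = card (T b) \<and> deg b = 2 * deg a \<and> odd (deg a) \<and> deg a \<noteq> 1"
      then show ?thesis
        using False Nb ab bNa involution_twins[OF ab(1-3)] no_involution_twins[OF ab(1)]
        unfolding graph_less_def by auto
    qed
  qed
  show ?thesis
  proof
    assume g: "graph_less V le x y"
    then have "le x y \<or> le y x" "N x \<noteq> N y" by (auto simp: graph_less_def nbhd_def)
    then show "le x y \<and> N x \<noteq> N y" using less[of y x] g assms by metis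
  qed (use less assms in blast)
qed

text \<open>\<open>graph_less\<close> sees its arguments only through closed neighbourhoods, so it
  is a relation between twin classes.\<close>

lemma graph_less_cong:
  assumes "x \<in> V" "t \<in> V" "y \<in> V" "N x = N t"
  shows "graph_less V le y x \<longleftrightarrow> graph_less V le y t"
proof -
  have "x \<in> nbhd V le u \<longleftrightarrow> t \<in> nbhd V le u" if "u \<in> V" for u
    using assms that nbhd_sym by blast
  moreover have "T x = T t" using assms(4) by (simp add: twins_def)
  ultimately show ?thesis using assms unfolding graph_less_def by simp
qed

lemma graph_less_cong_left:
  assumes "y \<in> V" "z \<in> V" "x \<in> V" "N y = N z"
  shows "graph_less V le y x \<longleftrightarrow> graph_less V le z x"
proof -
  have "y \<in> nbhd V le u \<longleftrightarrow> z \<in> nbhd V le u" if "u \<in> V" for u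
    using assms that nbhd_sym by blast
  moreover have "T y = T z" using assms(4) by (simp add: twins_def)
  ultimately show ?thesis using assms unfolding graph_less_def by simp
qed

text \<open>Below the top \<open>t\<close> of the class lie exactly the class and the non-twins
  given by \<open>graph_less\<close>, so \<open>M\<close> is the order of \<open>t\<close>. Counting
  elements of order \<open>d\<close> below \<open>t\<close> gives the recursion for the later
  induction.\<close>

lemma card_twins_deg_eq:
  assumes good: "\<And>z. z \<in> V \<Longrightarrow> N z = V \<Longrightarrow> \<exists>p k. prime p \<and> deg z = p ^ k"
    and "x \<in> V"
  defines "M \<equiv> card (T x) + card {y \<in> V. graph_less V le y x}"
  shows "card {y \<in> V. N y = N x \<and> deg y = d} + card {y \<in> V. graph_less V le y x \<and> deg y = d} =
    (if d dvd M then totient d else 0)"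
proof -
  obtain t where t: "t \<in> T x" "\<And>y. y \<in> T x \<Longrightarrow> le y t" using twins_top assms(2) by blast
  have V: "t \<in> V" "N t = N x" using t by (auto simp: twins_iff)
  have down: "le y t \<longleftrightarrow> y \<in> T x \<or> graph_less V le y x" if "y \<in> V" for y
    using graph_less_cong[of x t y] graph_less_iff[OF good that V(1)] that V assms(2) t(2)
    by (auto simp: twins_iff)
  have disj: "N y \<noteq> N x" if "graph_less V le y x" for y
    using that by (simp add: graph_less_def)
  have "{y \<in> V. le y t} = T x \<union> {y \<in> V. graph_less V le y x}"
    using down by (auto simp: twins_iff)
  moreover have "card \<dots> = M"
    unfolding M_def using disj finite_V finite_twins
    by (intro card_Un_disjoint) (auto simp: twins_iff)
  ultimately have M: "M = deg t" using card_down[OF V(1)] by simp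
  have "{y \<in> V. le y t \<and> deg y = d} =
      {y \<in> V. N y = N x \<and> deg y = d} \<union> {y \<in> V. graph_less V le y x \<and> deg y = d}"
    using down by (auto simp: twins_iff)
  moreover have "card \<dots> = card {y \<in> V. N y = N x \<and> deg y = d}
      + card {y \<in> V. graph_less V le y x \<and> deg y = d}"
    using disj finite_V by (intro card_Un_disjoint) auto
  moreover have "card {y \<in> V. le y t \<and> deg y = d} = (if d dvd M then totient d else 0)"
  proof (cases "d dvd M")
    case True
    then show ?thesis using card_deg_eq[OF V(1)] M by simp
  next
    case False
    then have "{y \<in> V. le y t \<and> deg y = d} = {}" using deg_dvd V(1) M by auto
    then show ?thesis using False by (metis card.empty)
  qed
  ultimately show ?thesis by simp
qed

section \<open>Dominating elements and the order of the group\<close>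

text \<open>An element above \<open>z\<close> of another order would have \<open>deg z\<close> as a
  middle divisor, making \<open>deg z\<close> a prime power. So \<open>z\<close> is a maximum: the
  group is cyclic and generated by \<open>z\<close>.\<close>

lemma all_below_if_not_prime_power:
  assumes "z \<in> V" "N z = V" "\<nexists>p k. prime p \<and> deg z = p ^ k"
  shows "w \<in> V \<Longrightarrow> le w z" and "card V = deg z"
proof -
  \<comment> \<open>Order 1 counts as a prime power, with exponent 0.\<close>
  have z1: "deg z \<noteq> 1" using assms(3) two_is_prime_nat by (metis power_0)
  have all: "le w z" if w: "w \<in> V" for w
  proof (rule ccontr)
    assume n: "\<not> le w z"
    then have zw: "le z w" using assms(2) w nbhd_iff by blast
    then have dvd: "deg z dvd deg w" using assms(1) w deg_dvd by blast
    have "deg z \<noteq> deg w" using n le_if_comparable_deg_le[of w z] zw assms(1) w by auto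
    then have "\<exists>p k. prime p \<and> deg w = p ^ k"
    proof (intro prime_power_if_middle_divisor[OF deg_pos[OF w] _ dvd])
      show "deg z > 1" using z1 deg_pos[OF assms(1)] by simp
      fix d assume "d dvd deg w"
      then obtain u where u: "u \<in> V" "le u w" "deg u = d" using ex_deg_eq w by blast
      then have "u \<in> N z" using assms(2) by simp
      then show "d dvd deg z \<or> deg z dvd d" using u assms(1) deg_dvd by (auto simp: nbhd_iff)
    qed
    then show False using dvd assms(3) divides_primepow_nat by metis
  qed
  then show "w \<in> V \<Longrightarrow> le w z" .
  have "{w \<in> V. le w z} = V" using all by blast
  then show "card V = deg z" using card_down[OF assms(1)] by simp
qed

text \<open>Cauchy supplies an element of order \<open>q\<close> for every prime \<open>q\<close>
  dividing \<open>card V\<close>; \<open>x\<close> is comparable with it, which leaves only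
  \<open>q = p\<close>.\<close>

lemma card_prime_power_if_dominating:
  assumes "x \<in> V" "N x = V" "deg x \<noteq> 1" "prime p" "deg x = p ^ k"
  shows "\<exists>j. card V = p ^ j"
proof (rule power_of_prime_if_unique_prime_factor)
  show "card V > 0" using assms(1) finite_V card_gt_0_iff by blast
  fix q assume q: "prime q" "q dvd card V"
  then obtain u where u: "u \<in> V" "deg u = q" using cauchy by blast
  then have "u \<in> N x" using assms by simp
  then have "q dvd p ^ k \<or> p ^ k dvd q" using u assms deg_dvd by (metis nbhd_iff)
  moreover have "k \<noteq> 0" using assms(3,5) by (metis power_0)
  then have "p dvd p ^ k" by simp
  ultimately show "q = p"
    using q(1) assms(4) by (metis dvd_trans prime_dvd_power primes_dvd_imp_eq)
qed

end

section \<open>Rearranging a graph isomorphism\<close>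

text \<open>Grouping by closed neighbourhood collects whole twin classes, since
  \<open>graph_less\<close> does not separate twins; an induction hypothesis can then be applied
  class by class.\<close>

lemma (in cyclic_preorder) card_graph_less_deg_eq:
  assumes "x \<in> V"
  shows "card {y \<in> V. graph_less V le y x \<and> deg y = d} =
    (\<Sum>K\<in>N ` {y \<in> V. graph_less V le y x}. card {y \<in> V. N y = K \<and> deg y = d})"
proof -
  let ?B = "{y \<in> V. graph_less V le y x}" and ?S = "{y \<in> V. graph_less V le y x \<and> deg y = d}"
  have "card ?S = (\<Sum>K\<in>N ` ?B. card {y \<in> ?S. N y = K})"
    unfolding card_eq_sum
    by (rule sum.group[symmetric]) (use finite_V in auto)
  also have "\<dots> = (\<Sum>K\<in>N ` ?B. card {y \<in> V. N y = K \<and> deg y = d})"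
  proof (intro sum.cong refl arg_cong[where f = card])
    fix K assume "K \<in> N ` ?B"
    then obtain z where z: "z \<in> V" "graph_less V le z x" "K = N z" by blast
    show "{y \<in> ?S. N y = K} = {y \<in> V. N y = K \<and> deg y = d}"
      using graph_less_cong_left[OF _ z(1) assms] z by blast
  qed
  finally show ?thesis .
qed

text \<open>Only comparability is assumed to be preserved: the graph does not record which of two
  adjacent elements is the power.\<close>

locale cyclic_preorder_graph_iso =
  A: cyclic_preorder V\<^sub>1 le\<^sub>1 deg\<^sub>1 + B: cyclic_preorder V\<^sub>2 le\<^sub>2 deg\<^sub>2
  for V\<^sub>1 :: "'a set" and le\<^sub>1 deg\<^sub>1 and V\<^sub>2 :: "'b set" and le\<^sub>2 deg\<^sub>2 +
  fixes f :: "'a \<Rightarrow> 'b"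
  assumes bij: "bij_betw f V\<^sub>1 V\<^sub>2"
    and comparable_iff: "\<lbrakk>x \<in> V\<^sub>1; y \<in> V\<^sub>1\<rbrakk> \<Longrightarrow>
      le\<^sub>1 x y \<or> le\<^sub>1 y x \<longleftrightarrow> le\<^sub>2 (f x) (f y) \<or> le\<^sub>2 (f y) (f x)"
begin

abbreviation "N\<^sub>1 \<equiv> nbhd V\<^sub>1 le\<^sub>1"
abbreviation "N\<^sub>2 \<equiv> nbhd V\<^sub>2 le\<^sub>2"

lemma image: "f ` V\<^sub>1 = V\<^sub>2" and inj: "inj_on f V\<^sub>1"
  using bij by (auto simp: bij_betw_def)

lemma f_mem: "x \<in> V\<^sub>1 \<Longrightarrow> f x \<in> V\<^sub>2"
  using image by blast

lemma Collect_image: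
  assumes "\<And>x. x \<in> V\<^sub>1 \<Longrightarrow> P x \<longleftrightarrow> Q (f x)"
  shows "{y \<in> V\<^sub>2. Q y} = f ` {x \<in> V\<^sub>1. P x}"
  unfolding image[symmetric] using assms by blast

lemma card_Collect_eq:
  assumes "\<And>x. x \<in> V\<^sub>1 \<Longrightarrow> P x \<longleftrightarrow> Q (f x)"
  shows "card {y \<in> V\<^sub>2. Q y} = card {x \<in> V\<^sub>1. P x}"
proof -
  have "inj_on f {x \<in> V\<^sub>1. P x}" by (rule inj_on_subset[OF inj]) blast
  then show ?thesis using Collect_image[of P Q, OF assms] by (simp add: card_image)
qed

lemma nbhd_image: "x \<in> V\<^sub>1 \<Longrightarrow> N\<^sub>2 (f x) = f ` N\<^sub>1 x"
  unfolding nbhd_def by (rule Collect_image) (rule comparable_iff)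

lemma nbhd_subset: "N\<^sub>1 x \<subseteq> V\<^sub>1"
  by (auto simp: nbhd_def)

lemma nbhd_mem_iff: "x \<in> V\<^sub>1 \<Longrightarrow> y \<in> V\<^sub>1 \<Longrightarrow> f y \<in> N\<^sub>2 (f x) \<longleftrightarrow> y \<in> N\<^sub>1 x"
  using inj_on_image_mem_iff[OF inj _ nbhd_subset] by (simp only: nbhd_image)

lemma nbhd_eq_iff: "x \<in> V\<^sub>1 \<Longrightarrow> y \<in> V\<^sub>1 \<Longrightarrow> N\<^sub>2 (f x) = N\<^sub>2 (f y) \<longleftrightarrow> N\<^sub>1 x = N\<^sub>1 y"
  using inj_on_image_eq_iff[OF inj nbhd_subset nbhd_subset] by (simp only: nbhd_image)

lemma nbhd_UNIV_iff: "x \<in> V\<^sub>1 \<Longrightarrow> N\<^sub>2 (f x) = V\<^sub>2 \<longleftrightarrow> N\<^sub>1 x = V\<^sub>1"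
  using inj_on_image_eq_iff[OF inj nbhd_subset order_refl, of x] by (simp only: nbhd_image image)

lemma card_twins_eq: "x \<in> V\<^sub>1 \<Longrightarrow> card (twins V\<^sub>2 le\<^sub>2 (f x)) = card (twins V\<^sub>1 le\<^sub>1 x)"
  unfolding twins_def by (rule card_Collect_eq) (simp add: nbhd_eq_iff)

lemma graph_less_image_iff:
  assumes "x \<in> V\<^sub>1" "y \<in> V\<^sub>1"
  shows "graph_less V\<^sub>2 le\<^sub>2 (f x) (f y) \<longleftrightarrow> graph_less V\<^sub>1 le\<^sub>1 x y"
proof -
  \<comment> \<open>Witnesses in \<open>V\<^sub>2\<close> are images of witnesses in
    \<open>V\<^sub>1\<close>, and every condition on them concerns closed neighbourhoods.\<close>
  have "(\<exists>u\<in>V\<^sub>2. N\<^sub>2 u \<noteq> V\<^sub>2 \<and> card (twins V\<^sub>2 le\<^sub>2 u) = 1 \<and> f y \<in> N\<^sub>2 u \<and> f x \<notin> N\<^sub>2 u) \<longleftrightarrow>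
      (\<exists>u\<in>V\<^sub>1. N\<^sub>1 u \<noteq> V\<^sub>1 \<and> card (twins V\<^sub>1 le\<^sub>1 u) = 1 \<and> y \<in> N\<^sub>1 u \<and> x \<notin> N\<^sub>1 u)"
    unfolding image[symmetric] bex_simps
    using assms nbhd_UNIV_iff card_twins_eq nbhd_mem_iff image by simp
  then show ?thesis
    unfolding graph_less_def
    using assms by (simp only: nbhd_UNIV_iff card_twins_eq nbhd_mem_iff nbhd_eq_iff)
qed

section \<open>Order counts in twin classes as graph invariants\<close>

text \<open>Induction on \<open>deg\<^sub>1 x\<close>: the number of elements of order
  \<open>d\<close> below the top of the class depends only on the top's order, which the graph
  determines, and the classes strictly below are settled already; subtraction leaves the class
  itself.\<close>

lemma card_fibres_eq:
  assumes good\<^sub>1: "\<And>z. z \<in> V\<^sub>1 \<Longrightarrow> N\<^sub>1 z = V\<^sub>1 \<Longrightarrow> \<exists>p k. prime p \<and> deg\<^sub>1 z = p ^ k"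
    and good\<^sub>2: "\<And>z. z \<in> V\<^sub>2 \<Longrightarrow> N\<^sub>2 z = V\<^sub>2 \<Longrightarrow> \<exists>p k. prime p \<and> deg\<^sub>2 z = p ^ k"
    and "x \<in> V\<^sub>1"
  shows "card {y \<in> V\<^sub>1. N\<^sub>1 y = N\<^sub>1 x \<and> deg\<^sub>1 y = d} =
    card {y \<in> V\<^sub>2. N\<^sub>2 y = N\<^sub>2 (f x) \<and> deg\<^sub>2 y = d}"
  using assms(3)
proof (induction "deg\<^sub>1 x" arbitrary: x rule: less_induct)
  case less
  define B\<^sub>1 where "B\<^sub>1 = {y \<in> V\<^sub>1. graph_less V\<^sub>1 le\<^sub>1 y x}"
  define B\<^sub>2 where "B\<^sub>2 = {y \<in> V\<^sub>2. graph_less V\<^sub>2 le\<^sub>2 y (f x)}"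
  have B\<^sub>2: "B\<^sub>2 = f ` B\<^sub>1"
    unfolding B\<^sub>1_def B\<^sub>2_def by (rule Collect_image) (simp add: graph_less_image_iff less.prems)
  have fin: "finite B\<^sub>1" "finite B\<^sub>2"
    using A.finite_V B.finite_V by (auto simp: B\<^sub>1_def B\<^sub>2_def)
  have IH: "card {y \<in> V\<^sub>1. N\<^sub>1 y = N\<^sub>1 z \<and> deg\<^sub>1 y = d} =
      card {y \<in> V\<^sub>2. N\<^sub>2 y = N\<^sub>2 (f z) \<and> deg\<^sub>2 y = d}" if z: "z \<in> B\<^sub>1" for z
  proof (rule less.hyps)
    have zV: "z \<in> V\<^sub>1" and "graph_less V\<^sub>1 le\<^sub>1 z x" using z by (auto simp: B\<^sub>1_def)
    then have le: "le\<^sub>1 z x" "N\<^sub>1 z \<noteq> N\<^sub>1 x"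
      using A.graph_less_iff[OF good\<^sub>1 zV less.prems] by auto
    \<comment> \<open>Elements below each other are twins, so for non-twins the order drops
      strictly.\<close>
    then have "\<not> le\<^sub>1 x z" using A.nbhd_eq_if_le_le zV less.prems by blast
    then show "deg\<^sub>1 z < deg\<^sub>1 x"
      using A.le_if_comparable_deg_le[of x z] zV less.prems le(1) not_le by blast
    show "z \<in> V\<^sub>1" by fact
  qed
  \<comment> \<open>Classes are indexed by their closed neighbourhoods, and \<open>f\<close> carries
    the indices over injectively; this reindexes the sum.\<close>
  have "N\<^sub>2 ` B\<^sub>2 = (`) f ` N\<^sub>1 ` B\<^sub>1"
    unfolding B\<^sub>2 image_image by (rule image_cong) (auto simp: B\<^sub>1_def nbhd_image)
  moreover have "inj_on ((`) f) (N\<^sub>1 ` B\<^sub>1)"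
    by (rule inj_on_subset[OF inj_on_image_Pow[OF inj]]) (use nbhd_subset in blast)
  ultimately have "(\<Sum>K\<in>N\<^sub>2 ` B\<^sub>2. card {y \<in> V\<^sub>2. N\<^sub>2 y = K \<and> deg\<^sub>2 y = d}) =
      (\<Sum>K\<in>N\<^sub>1 ` B\<^sub>1. card {y \<in> V\<^sub>2. N\<^sub>2 y = f ` K \<and> deg\<^sub>2 y = d})"
    by (simp add: sum.reindex)
  also have "\<dots> = (\<Sum>K\<in>N\<^sub>1 ` B\<^sub>1. card {y \<in> V\<^sub>1. N\<^sub>1 y = K \<and> deg\<^sub>1 y = d})"
  proof (rule sum.cong[OF refl])
    fix K assume "K \<in> N\<^sub>1 ` B\<^sub>1"
    then obtain z where z: "z \<in> B\<^sub>1" "K = N\<^sub>1 z" by blast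
    then have "z \<in> V\<^sub>1" by (simp add: B\<^sub>1_def)
    then show "card {y \<in> V\<^sub>2. N\<^sub>2 y = f ` K \<and> deg\<^sub>2 y = d} = card {y \<in> V\<^sub>1. N\<^sub>1 y = K \<and> deg\<^sub>1 y = d}"
      using IH[OF z(1)] z(2) nbhd_image by simp
  qed
  finally have lower: "card {y \<in> V\<^sub>2. graph_less V\<^sub>2 le\<^sub>2 y (f x) \<and> deg\<^sub>2 y = d} =
      card {y \<in> V\<^sub>1. graph_less V\<^sub>1 le\<^sub>1 y x \<and> deg\<^sub>1 y = d}"
    using A.card_graph_less_deg_eq[OF less.prems] B.card_graph_less_deg_eq[OF f_mem[OF less.prems]]
    by (simp only: B\<^sub>1_def B\<^sub>2_def)
  have "card B\<^sub>2 = card B\<^sub>1"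
    unfolding B\<^sub>1_def B\<^sub>2_def by (rule card_Collect_eq) (simp add: graph_less_image_iff less.prems)
  \<comment> \<open>This equates the two instances of \<open>M\<close> in
    \<open>card_twins_deg_eq\<close>.\<close>
  then have "card (twins V\<^sub>1 le\<^sub>1 x) + card {y \<in> V\<^sub>1. graph_less V\<^sub>1 le\<^sub>1 y x} =
      card (twins V\<^sub>2 le\<^sub>2 (f x)) + card {y \<in> V\<^sub>2. graph_less V\<^sub>2 le\<^sub>2 y (f x)}"
    using card_twins_eq[OF less.prems] by (simp add: B\<^sub>1_def B\<^sub>2_def)
  then show ?case
    using A.card_twins_deg_eq[OF good\<^sub>1 less.prems, of d]
      B.card_twins_deg_eq[OF good\<^sub>2 f_mem[OF less.prems], of d] lower by simp
qed

section \<open>The exceptional case and the rearrangement\<close>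

text \<open>The image of \<open>z\<close> may have order 1, so the element \<open>e\<close> of order
  1 is carried along: both images dominate and at most one has order 1. Prime-power order of the
  other would make \<open>card V\<^sub>2\<close>, which is \<open>deg\<^sub>1 z\<close>, a prime
  power.\<close>

lemma not_prime_power_transfer:
  assumes z: "z \<in> V\<^sub>1" "N\<^sub>1 z = V\<^sub>1" "\<nexists>p k. prime p \<and> deg\<^sub>1 z = p ^ k"
  shows "\<exists>y\<in>V\<^sub>2. N\<^sub>2 y = V\<^sub>2 \<and> (\<nexists>p k. prime p \<and> deg\<^sub>2 y = p ^ k)"
proof -
  obtain e where e: "e \<in> V\<^sub>1" "deg\<^sub>1 e = 1" using A.ex_deg_eq[OF z(1), of 1] by auto
  have "deg\<^sub>1 z \<noteq> 1" using z(3) two_is_prime_nat by (metis power_0)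
  then have "e \<noteq> z" using e by auto
  then have ne: "f e \<noteq> f z" using e z inj by (auto dest: inj_onD)
  have "\<exists>y\<in>{f e, f z}. deg\<^sub>2 y \<noteq> 1"
  proof (rule ccontr)
    assume "\<not> ?thesis"
    then have one: "deg\<^sub>2 (f e) = 1" "deg\<^sub>2 (f z) = 1" by auto
    have "{f e, f z} \<subseteq> {y \<in> V\<^sub>2. le\<^sub>2 y (f z) \<and> deg\<^sub>2 y = 1}"
      using one f_mem e(1) z(1) B.le_if_deg_eq_1 by auto
    then have "card {f e, f z} \<le> card {y \<in> V\<^sub>2. le\<^sub>2 y (f z) \<and> deg\<^sub>2 y = 1}"
      using B.finite_V by (intro card_mono) auto
    also have "\<dots> = 1" using B.card_deg_eq[OF f_mem[OF z(1)], of 1] by simp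
    finally show False using ne by simp
  qed
  then obtain y where y: "y \<in> {f e, f z}" "deg\<^sub>2 y \<noteq> 1" by blast
  then have yV: "y \<in> V\<^sub>2" "N\<^sub>2 y = V\<^sub>2"
    using nbhd_UNIV_iff A.nbhd_if_deg_eq_1 e z f_mem by auto
  have "card V\<^sub>2 = deg\<^sub>1 z"
    using A.all_below_if_not_prime_power(2)[OF z] bij_betw_same_card[OF bij] by simp
  then have "\<nexists>p k. prime p \<and> deg\<^sub>2 y = p ^ k"
    using B.card_prime_power_if_dominating[OF yV y(2)] z(3) by metis
  then show ?thesis using yV by blast
qed

lemma inverse: "cyclic_preorder_graph_iso V\<^sub>2 le\<^sub>2 deg\<^sub>2 V\<^sub>1 le\<^sub>1 deg\<^sub>1 (inv_into V\<^sub>1 f)"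
proof unfold_locales
  show "bij_betw (inv_into V\<^sub>1 f) V\<^sub>2 V\<^sub>1" using bij by (rule bij_betw_inv_into)
  fix x y assume "x \<in> V\<^sub>2" "y \<in> V\<^sub>2"
  then show "le\<^sub>2 x y \<or> le\<^sub>2 y x \<longleftrightarrow> le\<^sub>1 (inv_into V\<^sub>1 f x) (inv_into V\<^sub>1 f y) \<or>
      le\<^sub>1 (inv_into V\<^sub>1 f y) (inv_into V\<^sub>1 f x)"
    using comparable_iff[of "inv_into V\<^sub>1 f x" "inv_into V\<^sub>1 f y"] image
    by (simp add: inv_into_into f_inv_into_f)
qed

text \<open>Generically, twin classes are matched order by order. In the exceptional case both
  preorders have a maximum and are divisibility of orders, so matching orders suffices.\<close>

lemma deg_preserving_bij:
  "\<exists>F. bij_betw F V\<^sub>1 V\<^sub>2 \<and> (\<forall>x\<in>V\<^sub>1. deg\<^sub>2 (F x) = deg\<^sub>1 x) \<and>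
    (\<forall>x\<in>V\<^sub>1. \<forall>y\<in>V\<^sub>1. le\<^sub>1 x y \<or> le\<^sub>1 y x \<longleftrightarrow> le\<^sub>2 (F x) (F y) \<or> le\<^sub>2 (F y) (F x))"
proof (cases "(\<forall>z\<in>V\<^sub>1. N\<^sub>1 z = V\<^sub>1 \<longrightarrow> (\<exists>p k. prime p \<and> deg\<^sub>1 z = p ^ k)) \<and>
    (\<forall>z\<in>V\<^sub>2. N\<^sub>2 z = V\<^sub>2 \<longrightarrow> (\<exists>p k. prime p \<and> deg\<^sub>2 z = p ^ k))")
  case True
  \<comment> \<open>Neighbourhoods on the left are pushed through \<open>f\<close> so that both
    labels live in \<open>V\<^sub>2\<close>; the resulting \<open>F x\<close> is a twin of
    \<open>f x\<close> with the order of \<open>x\<close>.\<close>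
  have "card {x \<in> V\<^sub>1. (f ` N\<^sub>1 x, deg\<^sub>1 x) = k} = card {y \<in> V\<^sub>2. (N\<^sub>2 y, deg\<^sub>2 y) = k}" for k
  proof (cases "fst k \<in> N\<^sub>2 ` V\<^sub>2")
    case T: True
    then obtain x where x: "x \<in> V\<^sub>1" "fst k = N\<^sub>2 (f x)" unfolding image[symmetric] by blast
    have "{y \<in> V\<^sub>1. (f ` N\<^sub>1 y, deg\<^sub>1 y) = k} = {y \<in> V\<^sub>1. N\<^sub>1 y = N\<^sub>1 x \<and> deg\<^sub>1 y = snd k}"
      using x nbhd_eq_iff[OF _ x(1)] nbhd_image by (auto simp: prod_eq_iff)
    moreover have "{y \<in> V\<^sub>2. (N\<^sub>2 y, deg\<^sub>2 y) = k} = {y \<in> V\<^sub>2. N\<^sub>2 y = N\<^sub>2 (f x) \<and> deg\<^sub>2 y = snd k}"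
      using x by (auto simp: prod_eq_iff)
    ultimately show ?thesis using card_fibres_eq[OF _ _ x(1), of "snd k"] True by simp
  next
    case False
    then have "{y \<in> V\<^sub>2. (N\<^sub>2 y, deg\<^sub>2 y) = k} = {}" by auto
    moreover have "{y \<in> V\<^sub>1. (f ` N\<^sub>1 y, deg\<^sub>1 y) = k} = {}"
      using False nbhd_image f_mem by fastforce
    ultimately show ?thesis by (simp only: card.empty)
  qed
  then obtain F where F: "bij_betw F V\<^sub>1 V\<^sub>2" "\<forall>x\<in>V\<^sub>1. (N\<^sub>2 (F x), deg\<^sub>2 (F x)) = (f ` N\<^sub>1 x, deg\<^sub>1 x)"
    using bij_betw_if_card_fibres_eq[OF A.finite_V B.finite_V,
        of "\<lambda>x. (f ` N\<^sub>1 x, deg\<^sub>1 x)" "\<lambda>y. (N\<^sub>2 y, deg\<^sub>2 y)"] by blast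
  have "le\<^sub>1 x y \<or> le\<^sub>1 y x \<longleftrightarrow> le\<^sub>2 (F x) (F y) \<or> le\<^sub>2 (F y) (F x)" if xy: "x \<in> V\<^sub>1" "y \<in> V\<^sub>1" for x y
  proof -
    have V: "F x \<in> V\<^sub>2" "F y \<in> V\<^sub>2" "f x \<in> V\<^sub>2" "f y \<in> V\<^sub>2"
      using F(1) xy f_mem bij_betwE by blast+
    have N: "N\<^sub>2 (F x) = N\<^sub>2 (f x)" "N\<^sub>2 (F y) = N\<^sub>2 (f y)" using F(2) xy nbhd_image by auto
    \<comment> \<open>Replacing either end of a pair by a twin does not change
      comparability.\<close>
    have "F y \<in> N\<^sub>2 (F x) \<longleftrightarrow> f y \<in> N\<^sub>2 (f x)"
      using N V B.nbhd_sym by metis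
    then show ?thesis using comparable_iff[OF xy] V by (simp add: nbhd_def)
  qed
  then show ?thesis using F by auto
next
  case False
  \<comment> \<open>The inverse isomorphism lets an exceptional element on the second side be
    transferred to the first.\<close>
  interpret I: cyclic_preorder_graph_iso V\<^sub>2 le\<^sub>2 deg\<^sub>2 V\<^sub>1 le\<^sub>1 deg\<^sub>1 "inv_into V\<^sub>1 f" by (rule inverse)
  have "\<exists>z\<in>V\<^sub>1. N\<^sub>1 z = V\<^sub>1 \<and> (\<nexists>p k. prime p \<and> deg\<^sub>1 z = p ^ k)"
  proof (rule ccontr)
    assume n: "\<not> ?thesis"
    then obtain z where "z \<in> V\<^sub>2" "N\<^sub>2 z = V\<^sub>2" "\<nexists>p k. prime p \<and> deg\<^sub>2 z = p ^ k" using False by blast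
    then show False using I.not_prime_power_transfer n by blast
  qed
  then obtain z\<^sub>1 where z\<^sub>1: "z\<^sub>1 \<in> V\<^sub>1" "N\<^sub>1 z\<^sub>1 = V\<^sub>1" "\<nexists>p k. prime p \<and> deg\<^sub>1 z\<^sub>1 = p ^ k"
    by blast
  then obtain z\<^sub>2 where z\<^sub>2: "z\<^sub>2 \<in> V\<^sub>2" "N\<^sub>2 z\<^sub>2 = V\<^sub>2" "\<nexists>p k. prime p \<and> deg\<^sub>2 z\<^sub>2 = p ^ k"
    using not_prime_power_transfer by blast
  note below\<^sub>1 = A.all_below_if_not_prime_power[OF z\<^sub>1]
  note below\<^sub>2 = B.all_below_if_not_prime_power[OF z\<^sub>2]
  have eq: "deg\<^sub>1 z\<^sub>1 = deg\<^sub>2 z\<^sub>2"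
    using below\<^sub>1(2) below\<^sub>2(2) bij_betw_same_card[OF bij] by simp
  have le_iff\<^sub>1: "le\<^sub>1 x y \<longleftrightarrow> deg\<^sub>1 x dvd deg\<^sub>1 y" if "x \<in> V\<^sub>1" "y \<in> V\<^sub>1" for x y
    using A.deg_dvd[OF that] A.le_if_deg_dvd[OF that z\<^sub>1(1)] below\<^sub>1(1) that by blast
  have le_iff\<^sub>2: "le\<^sub>2 x y \<longleftrightarrow> deg\<^sub>2 x dvd deg\<^sub>2 y" if "x \<in> V\<^sub>2" "y \<in> V\<^sub>2" for x y
    using B.deg_dvd[OF that] B.le_if_deg_dvd[OF that z\<^sub>2(1)] below\<^sub>2(1) that by blast
  have dvd\<^sub>1: "deg\<^sub>1 x dvd deg\<^sub>1 z\<^sub>1" if "x \<in> V\<^sub>1" for x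
    using le_iff\<^sub>1[OF that z\<^sub>1(1)] below\<^sub>1(1)[OF that] by blast
  have dvd\<^sub>2: "deg\<^sub>2 y dvd deg\<^sub>1 z\<^sub>1" if "y \<in> V\<^sub>2" for y
    unfolding eq using le_iff\<^sub>2[OF that z\<^sub>2(1)] below\<^sub>2(1)[OF that] by blast
  have "card {x \<in> V\<^sub>1. deg\<^sub>1 x = d} = card {y \<in> V\<^sub>2. deg\<^sub>2 y = d}" for d
  proof (cases "d dvd deg\<^sub>1 z\<^sub>1")
    case True
    have "{x \<in> V\<^sub>1. deg\<^sub>1 x = d} = {x \<in> V\<^sub>1. le\<^sub>1 x z\<^sub>1 \<and> deg\<^sub>1 x = d}"
      by (rule Collect_cong) (use below\<^sub>1(1) in auto)
    moreover have "{y \<in> V\<^sub>2. deg\<^sub>2 y = d} = {y \<in> V\<^sub>2. le\<^sub>2 y z\<^sub>2 \<and> deg\<^sub>2 y = d}"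
      by (rule Collect_cong) (use below\<^sub>2(1) in auto)
    ultimately show ?thesis
      using A.card_deg_eq[OF z\<^sub>1(1) True] B.card_deg_eq[OF z\<^sub>2(1) True[unfolded eq]] by (simp only:)
  next
    case False
    then have "{x \<in> V\<^sub>1. deg\<^sub>1 x = d} = {}" "{y \<in> V\<^sub>2. deg\<^sub>2 y = d} = {}"
      using dvd\<^sub>1 dvd\<^sub>2 by blast+
    then show ?thesis by (simp only: card.empty)
  qed
  then obtain F where F: "bij_betw F V\<^sub>1 V\<^sub>2" "\<forall>x\<in>V\<^sub>1. deg\<^sub>2 (F x) = deg\<^sub>1 x"
    using bij_betw_if_card_fibres_eq[OF A.finite_V B.finite_V, of deg\<^sub>1 deg\<^sub>2] by blast
  have "le\<^sub>1 x y \<longleftrightarrow> le\<^sub>2 (F x) (F y)" if xy: "x \<in> V\<^sub>1" "y \<in> V\<^sub>1" for x y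
  proof -
    have V: "F x \<in> V\<^sub>2" "F y \<in> V\<^sub>2" using F(1) xy bij_betwE by blast+
    show ?thesis using le_iff\<^sub>1[OF xy] le_iff\<^sub>2[OF V] F(2) xy by simp
  qed
  then show ?thesis using F by blast
qed

text \<open>On comparable pairs the preorder is the comparison of orders, and the bijection just
  built keeps comparability and orders.\<close>

lemma le_preserving_bij:
  "\<exists>F. bij_betw F V\<^sub>1 V\<^sub>2 \<and> (\<forall>x\<in>V\<^sub>1. \<forall>y\<in>V\<^sub>1. le\<^sub>1 x y \<longleftrightarrow> le\<^sub>2 (F x) (F y))"
proof -
  obtain F where F: "bij_betw F V\<^sub>1 V\<^sub>2" "\<And>x. x \<in> V\<^sub>1 \<Longrightarrow> deg\<^sub>2 (F x) = deg\<^sub>1 x"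
    and cmp: "\<And>x y. x \<in> V\<^sub>1 \<Longrightarrow> y \<in> V\<^sub>1 \<Longrightarrow>
      le\<^sub>1 x y \<or> le\<^sub>1 y x \<longleftrightarrow> le\<^sub>2 (F x) (F y) \<or> le\<^sub>2 (F y) (F x)"
    using deg_preserving_bij by blast
  have "le\<^sub>1 x y \<longleftrightarrow> le\<^sub>2 (F x) (F y)" if xy: "x \<in> V\<^sub>1" "y \<in> V\<^sub>1" for x y
  proof -
    have V: "F x \<in> V\<^sub>2" "F y \<in> V\<^sub>2" using F(1) xy bij_betwE by blast+
    have "le\<^sub>1 x y \<longleftrightarrow> (le\<^sub>1 x y \<or> le\<^sub>1 y x) \<and> deg\<^sub>1 x \<le> deg\<^sub>1 y"
      using A.le_if_comparable_deg_le[OF xy] A.deg_dvd[OF xy] A.deg_pos[OF xy(2)] by (auto dest: dvd_imp_le)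
    moreover have "le\<^sub>2 (F x) (F y) \<longleftrightarrow> (le\<^sub>2 (F x) (F y) \<or> le\<^sub>2 (F y) (F x)) \<and> deg\<^sub>2 (F x) \<le> deg\<^sub>2 (F y)"
      using B.le_if_comparable_deg_le[OF V] B.deg_dvd[OF V] B.deg_pos[OF V(2)] by (auto dest: dvd_imp_le)
    ultimately show ?thesis using cmp[OF xy] F(2) xy by simp
  qed
  then show ?thesis using F(1) by blast
qed

end

section \<open>Cyclic subgroups and the power graph\<close>

lemma (in group) generate_singleton_mono:
  assumes "x \<in> generate G {y}" "y \<in> carrier G"
  shows "generate G {x} \<subseteq> generate G {y}"
  using assms by (intro generate_subgroup_incl generate_is_subgroup) auto

lemma (in group) generate_singleton_carrier:
  "y \<in> carrier G \<Longrightarrow> generate G {y} \<subseteq> carrier G"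
  using generate_incl by simp

lemma (in group) self_in_generate: "x \<in> generate G {x}"
  by (rule generate.incl) simp

lemma (in group) ord_pow_eq:
  assumes "x \<in> carrier G" "ord x > 0"
  shows "ord (x [^] (k::nat)) = ord x div gcd (ord x) k"
  using assms by (simp add: ord_pow_gen)

section \<open>Orders inside finite cyclic subgroups\<close>

text \<open>For powers of \<open>z\<close> with exponents \<open>a\<close> and \<open>b\<close>,
  divisibility of the orders says that \<open>gcd ?n b\<close> divides \<open>gcd ?n a\<close> and
  hence \<open>a\<close>. Bezout writes \<open>gcd ?n b\<close> through \<open>?n\<close> and
  \<open>b\<close>, which exhibits \<open>x\<close> as a power of \<open>y\<close>.\<close>

lemma (in group) in_generate_if_ord_dvd:
  assumes fin: "finite (carrier G)" and z: "z \<in> carrier G"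
    and xy: "x \<in> generate G {z}" "y \<in> generate G {z}" and dvd: "ord x dvd ord y"
  shows "x \<in> generate G {y}"
proof -
  let ?n = "ord z"
  have n: "?n > 0" using ord_ge_1[OF fin z] by simp
  obtain a b :: nat where a: "x = z [^] a" and b: "y = z [^] b"
    using xy generate_pow_on_finite_carrier[OF fin z] by blast
  obtain s where s: "?n div gcd ?n b = (?n div gcd ?n a) * s"
    using dvd ord_pow_eq[OF z n] a b by (auto elim: dvdE)
  have "gcd ?n a * (?n div gcd ?n a) = (gcd ?n b * s) * (?n div gcd ?n a)"
    using s by (metis dvd_mult_div_cancel gcd_dvd1 mult.assoc mult.commute)
  moreover have "?n div gcd ?n a > 0" using n by (simp add: div_greater_zero_iff gcd_le1_nat)
  ultimately have "gcd ?n a = gcd ?n b * s" by (metis mult_cancel2 less_irrefl)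
  then obtain t where t: "a = gcd ?n b * t" by (metis dvd_mult_left gcd_dvd2 dvdE)
  obtain u v :: int where uv: "u * int ?n + v * int b = int (gcd ?n b)"
    using bezout_int[of "int ?n" "int b"] by auto
  have y: "y \<in> carrier G" using b z by simp
  have "int a = int (gcd ?n b) * int t" unfolding t by simp
  then have "int a = int ?n * (u * int t) + int b * (v * int t)"
    unfolding uv[symmetric] by (simp add: algebra_simps)
  then have "x = z [^] (int ?n * (u * int t)) \<otimes> z [^] (int b * (v * int t))"
    unfolding a using int_pow_mult[OF z] int_pow_int[of G z a] by simp
  \<comment> \<open>The first factor is the identity, its exponent being a multiple of the order of
    \<open>z\<close>.\<close>
  also have "\<dots> = y [^] (v * int t)"
    using b z by (simp add: int_pow_int flip: int_pow_pow)
  finally show ?thesis using generate_pow[OF y] by blast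
qed

text \<open>\<open>x [^] k\<close> has order \<open>?n div gcd ?n k\<close>, so order
  \<open>d\<close> means \<open>gcd k ?n = c\<close> where \<open>?n = d * c\<close>; the exponents
  with this gcd number \<open>totient d\<close>.\<close>

lemma (in group) card_generate_ord_eq:
  assumes fin: "finite (carrier G)" and x: "x \<in> carrier G" and d: "d dvd ord x"
  shows "card {y \<in> carrier G. y \<in> generate G {x} \<and> ord y = d} = totient d"
proof -
  let ?n = "ord x"
  have n: "?n > 0" using ord_ge_1[OF fin x] by simp
  obtain c where c: "?n = d * c" using d by blast
  have cd: "c > 0" "d > 0" using c n by auto
  \<comment> \<open>Exponents run from 1 to \<open>?n\<close>, the last one giving the identity,
    because the gcd count below uses this range.\<close>
  have inj: "inj_on (\<lambda>k. x [^] k) {0<..?n}"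
    using ord_inj'[OF x] by (simp add: atLeastSucAtMost_greaterThanAtMost)
  have "(\<lambda>k. x [^] k) ` {0<..?n} = generate G {x}"
  proof (rule card_subset_eq)
    show "finite (generate G {x})"
      using generate_singleton_carrier[OF x] fin finite_subset by blast
    show "(\<lambda>k. x [^] k) ` {0<..?n} \<subseteq> generate G {x}"
      using generate_pow_on_finite_carrier[OF fin x] by blast
    show "card ((\<lambda>k. x [^] k) ` {0<..?n}) = card (generate G {x})"
      using card_image[OF inj] generate_pow_card[OF x] by simp
  qed
  then have "{y \<in> carrier G. y \<in> generate G {x} \<and> ord y = d} = {y \<in> (\<lambda>k. x [^] k) ` {0<..?n}. ord y = d}"
    using generate_singleton_carrier[OF x] by auto
  also have "\<dots> = (\<lambda>k. x [^] k) ` {k \<in> {0<..?n}. gcd k ?n = c}"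
  proof -
    have "ord (x [^] k) = d \<longleftrightarrow> gcd k ?n = c" for k :: nat
    proof -
      have "ord (x [^] k) * gcd k ?n = d * c"
        using ord_pow_eq[OF x n] c by (simp add: gcd.commute)
      then show ?thesis using cd by (metis mult_cancel_left mult_cancel_right less_irrefl)
    qed
    then show ?thesis by blast
  qed
  also have "card \<dots> = card {k \<in> {0<..?n}. gcd k ?n = c}"
    by (rule card_image) (rule inj_on_subset[OF inj], blast)
  also have "\<dots> = totient d"
    using card_gcd_eq_totient[OF n, of c] c cd by simp
  finally show ?thesis .
qed

text \<open>Cauchy's theorem, from Sylow's with exponent 1: a non-identity element of a subgroup of
  order \<open>p\<close> has order \<open>p\<close>.\<close>

lemma (in group) exists_ord_eq_prime:
  assumes fin: "finite (carrier G)" and p: "prime p" "p dvd card (carrier G)"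
  shows "\<exists>x\<in>carrier G. ord x = p"
proof -
  obtain m where "order G = p ^ 1 * m" using p(2) by (auto simp: order_def)
  then obtain H where H: "subgroup H G" "card H = p ^ 1"
    using sylow_thm[OF p(1) is_group _ fin] by blast
  have "card H > 1" using H(2) prime_gt_1_nat[OF p(1)] by simp
  then obtain x where x: "x \<in> H" "x \<noteq> \<one>"
    by (metis One_nat_def card.empty card.insert card.infinite empty_iff finite.emptyI insertI1
        less_irrefl not_less_zero subsetI subset_singletonD)
  have xG: "x \<in> carrier G" using x H(1) subgroup.mem_carrier by metis
  interpret H: group "G\<lparr>carrier := H\<rparr>" by (rule subgroup_imp_group[OF H(1)])
  have "x [^] p = \<one>"
    using H.pow_order_eq_1[of x] x H(2) nat_pow_consistent[of x p H] by (simp add: order_def)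
  then have "ord x dvd p" using pow_eq_id[OF xG] by simp
  moreover have "ord x \<noteq> 1" using ord_eq_1[OF xG] x(2) by simp
  ultimately have "ord x = p" using p(1) by (metis prime_nat_iff)
  then show ?thesis using xG by blast
qed

lemma (in group) cyclic_preorder_generate:
  assumes fin: "finite (carrier G)"
  shows "cyclic_preorder (carrier G) (\<lambda>x y. x \<in> generate G {y}) ord"
proof
  show "finite (carrier G)" by fact
  show "x \<in> generate G {x}" for x by (rule self_in_generate)
  show "x \<in> generate G {z}"
    if "y \<in> carrier G" "z \<in> carrier G" "x \<in> generate G {y}" "y \<in> generate G {z}" for x y z
    using generate_singleton_mono[OF that(4,2)] that(3) by blast
  show "\<exists>e\<in>carrier G. \<forall>x\<in>carrier G. e \<in> generate G {x}"
    using generate.one by (intro bexI[of _ \<one>]) auto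
  show "ord x > 0" if "x \<in> carrier G" for x
    using ord_ge_1[OF fin that] by simp
  show "ord x dvd ord y" if x: "x \<in> carrier G" and y: "y \<in> carrier G" and xy: "x \<in> generate G {y}" for x y
  proof -
    obtain k :: nat where k: "x = y [^] k"
      using xy generate_pow_on_finite_carrier[OF fin y] by blast
    have "x [^] ord y = y [^] (k * ord y)" unfolding k using y by (simp add: nat_pow_pow)
    also have "\<dots> = \<one>" using pow_eq_id[OF y] by simp
    finally show ?thesis using pow_eq_id[OF x] by simp
  qed
  show "x \<in> generate G {y}"
    if "z \<in> carrier G" "x \<in> generate G {z}" "y \<in> generate G {z}" "ord x dvd ord y"
    for x y z
    using in_generate_if_ord_dvd[OF fin that] .
  show "card {y \<in> carrier G. y \<in> generate G {x} \<and> ord y = d} = totient d"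
    if "x \<in> carrier G" "d dvd ord x" for x d
    using card_generate_ord_eq[OF fin that] .
  show "\<exists>x\<in>carrier G. ord x = p" if "prime p" "p dvd card (carrier G)" for p
    using exists_ord_eq_prime[OF fin that] .
qed

section \<open>Reduction to subgroups generated by one element\<close>

text \<open>Integer powers agree in a subgroup and in the group, so cyclicity of the restricted
  structure means generation by one element inside \<open>G\<close>.\<close>

lemma (in group) cyclic_subgroups_eq: "cyclic_subgroups G = (\<lambda>x. generate G {x}) ` carrier G"
proof -
  have cyclic: "cyclic_group (G\<lparr>carrier := C\<rparr>) \<longleftrightarrow> (\<exists>x\<in>C. C = generate G {x})" if C: "subgroup C G" for C
  proof -
    interpret C: group "G\<lparr>carrier := C\<rparr>" by (rule subgroup_imp_group[OF C])
    have "range (\<lambda>n::int. x [^]\<^bsub>G\<lparr>carrier := C\<rparr>\<^esub> n) = generate G {x}" if "x \<in> C" for x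
      using generate_pow[OF subgroup.mem_carrier[OF C that]] int_pow_consistent[OF C that] by auto
    then show ?thesis unfolding C.cyclic_group by auto
  qed
  show ?thesis
  proof
    show "cyclic_subgroups G \<subseteq> (\<lambda>x. generate G {x}) ` carrier G"
    proof
      fix C assume "C \<in> cyclic_subgroups G"
      then have C: "subgroup C G" "cyclic_group (G\<lparr>carrier := C\<rparr>)" by (auto simp: cyclic_subgroups_def)
      then obtain x where x: "x \<in> C" "C = generate G {x}" using cyclic by blast
      then show "C \<in> (\<lambda>x. generate G {x}) ` carrier G"
        using subgroup.mem_carrier[OF C(1) x(1)] by blast
    qed
    show "(\<lambda>x. generate G {x}) ` carrier G \<subseteq> cyclic_subgroups G"
    proof
      fix C assume "C \<in> (\<lambda>x. generate G {x}) ` carrier G"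
      then obtain x where x: "x \<in> carrier G" "C = generate G {x}" by blast
      then have C: "subgroup C G" using generate_is_subgroup[of "{x}"] by simp
      moreover have "x \<in> C" using self_in_generate x(2) by simp
      ultimately show "C \<in> cyclic_subgroups G"
        using cyclic x(2) by (auto simp: cyclic_subgroups_def)
    qed
  qed
qed

lemma power_graph_arcs:
  assumes "group G"
  shows "(x, y) \<in> parcs (power_graph G) \<longleftrightarrow> x \<in> carrier G \<and> y \<in> carrier G \<and> x \<noteq> y \<and>
    (x \<in> generate G {y} \<or> y \<in> generate G {x})"
  using group.generate_pow[OF assms] by (auto simp: power_graph_def)

text \<open>Adjacency can be traded for comparability: the diagonal, absent from the arcs, is always
  comparable because every element lies in the subgroup it generates.\<close>

lemma digraph_iso_power_graph_iff:
  assumes "group G" "finite (carrier G)" "group H"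
  shows "digraph_iso (with_proj (power_graph G)) (with_proj (power_graph H)) \<longleftrightarrow>
    (\<exists>f. bij_betw f (carrier G) (carrier H) \<and> (\<forall>x\<in>carrier G. \<forall>y\<in>carrier G.
      x \<in> generate G {y} \<or> y \<in> generate G {x} \<longleftrightarrow>
      f x \<in> generate H {f y} \<or> f y \<in> generate H {f x}))"
    (is "_ \<longleftrightarrow> (\<exists>f. ?bij f \<and> ?cmp f)")
proof
  interpret pair_graph "power_graph G" by (rule pair_graph_power_graph[OF assms(2)])
  let ?A = "parcs (power_graph G)" and ?B = "parcs (power_graph H)"
  have verts: "pverts (power_graph G) = carrier G" "pverts (power_graph H) = carrier H"
    by (simp_all add: power_graph_def)
  {
    assume "digraph_iso (with_proj (power_graph G)) (with_proj (power_graph H))"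
    then obtain hom where hom: "pre_digraph.digraph_isomorphism (with_proj (power_graph G)) hom"
      and app: "with_proj (power_graph H) = app_iso hom (with_proj (power_graph G))"
      by (auto simp: digraph_iso_def)
    define f where "f = iso_verts hom"
    have inj: "inj_on f (carrier G)"
      using hom verts by (simp add: pre_digraph.digraph_isomorphism_def f_def)
    \<comment> \<open>Both graphs have the projections as tail and head, so the arc map is
      determined by the vertex map.\<close>
    have tl: "iso_tail hom = fst" "iso_head hom = snd"
      and imV: "f ` carrier G = carrier H" and imA: "iso_arcs hom ` ?A = ?B"
      using app verts by (simp_all add: app_iso_def with_proj_def f_def)
    have "iso_arcs hom a = (f (fst a), f (snd a))" if "a \<in> ?A" for a
      using hom that tl by (simp add: pre_digraph.digraph_isomorphism_def f_def prod_eq_iff)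
    then have B: "?B = map_prod f f ` ?A"
      using imA by (metis (no_types, lifting) image_cong map_prod_def case_prod_beta)
    have arc: "(f x, f y) \<in> ?B \<longleftrightarrow> (x, y) \<in> ?A" if "x \<in> carrier G" "y \<in> carrier G" for x y
    proof
      assume "(f x, f y) \<in> ?B"
      then obtain u v where uv: "(u, v) \<in> ?A" "f x = f u" "f y = f v" using B by auto
      then have "u \<in> carrier G" "v \<in> carrier G" using power_graph_arcs[OF assms(1)] by auto
      then show "(x, y) \<in> ?A" using uv that inj by (metis inj_onD)
    qed (use B in force)
    have "?cmp f"
    proof (intro ballI)
      fix x y assume xy: "x \<in> carrier G" "y \<in> carrier G"
      show "x \<in> generate G {y} \<or> y \<in> generate G {x} \<longleftrightarrow>
        f x \<in> generate H {f y} \<or> f y \<in> generate H {f x}"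
      proof (cases "x = y")
        case True
        then show ?thesis using group.self_in_generate assms(1,3) by metis
      next
        case False
        then have "f x \<noteq> f y" using inj xy by (metis inj_onD)
        then show ?thesis
          using arc[OF xy] False xy imV
            power_graph_arcs[OF assms(1), of x y] power_graph_arcs[OF assms(3), of "f x" "f y"] by blast
      qed
    qed
    then show "\<exists>f. ?bij f \<and> ?cmp f" using inj imV by (auto simp: bij_betw_def)
  }
  assume "\<exists>f. ?bij f \<and> ?cmp f"
  then obtain f where f: "?bij f" "?cmp f" by blast
  have inj: "inj_on f (carrier G)" and im: "f ` carrier G = carrier H"
    using f(1) by (auto simp: bij_betw_def)
  define hom where "hom = \<lparr>iso_verts = f, iso_arcs = map_prod f f, iso_head = snd, iso_tail = fst\<rparr>"
  have "?A \<subseteq> carrier G \<times> carrier G" using power_graph_arcs[OF assms(1)] by auto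
  then have "inj_on (map_prod f f) ?A"
    using map_prod_inj_on[OF inj inj] inj_on_subset by blast
  then have iso: "pre_digraph.digraph_isomorphism (with_proj (power_graph G)) hom"
    using inj wf_digraph_axioms verts by (simp add: pre_digraph.digraph_isomorphism_def hom_def)
  have "?B = map_prod f f ` ?A"
  proof
    show "?B \<subseteq> map_prod f f ` ?A"
    proof
      fix b assume b: "b \<in> ?B"
      obtain u v where uv: "b = (u, v)" by fastforce
      then have "u \<in> carrier H" "v \<in> carrier H" using b power_graph_arcs[OF assms(3)] by auto
      then obtain x y where xy: "x \<in> carrier G" "y \<in> carrier G" "u = f x" "v = f y"
        using im by (metis imageE)
      then have "(x, y) \<in> ?A"
        using b uv f(2) power_graph_arcs[OF assms(3), of u v] power_graph_arcs[OF assms(1), of x y] by blast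
      then show "b \<in> map_prod f f ` ?A" using uv xy by force
    qed
    show "map_prod f f ` ?A \<subseteq> ?B"
    proof
      fix b assume "b \<in> map_prod f f ` ?A"
      then obtain x y where xy: "b = (f x, f y)" "(x, y) \<in> ?A" by auto
      then have *: "x \<in> carrier G" "y \<in> carrier G" "x \<noteq> y" "x \<in> generate G {y} \<or> y \<in> generate G {x}"
        using power_graph_arcs[OF assms(1), of x y] by auto
      then have "f x \<noteq> f y" using inj by (metis inj_onD)
      then show "b \<in> ?B"
        using xy(1) * f(2) im power_graph_arcs[OF assms(3), of "f x" "f y"] by blast
    qed
  qed
  then have "with_proj (power_graph H) = app_iso hom (with_proj (power_graph G))"
    using im verts by (simp add: app_iso_def with_proj_def hom_def)
  then show "digraph_iso (with_proj (power_graph G)) (with_proj (power_graph H))"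
    using iso by (auto simp: digraph_iso_def)
qed

section \<open>Passing between elements and cyclic subgroups\<close>

text \<open>The generators of a finite cyclic group are its elements of full order. Their number
  depends only on the size of the group, which \<open>\<sigma>\<close> will preserve.\<close>

lemma (in group) card_same_generate:
  assumes fin: "finite (carrier G)" and x: "x \<in> carrier G"
  shows "card {y \<in> carrier G. generate G {y} = generate G {x}} = totient (card (generate G {x}))"
proof -
  have "generate G {y} = generate G {x} \<longleftrightarrow> y \<in> generate G {x} \<and> ord y = ord x"
    if y: "y \<in> carrier G" for y
  proof
    assume "generate G {y} = generate G {x}"
    then show "y \<in> generate G {x} \<and> ord y = ord x"
      using self_in_generate generate_pow_card x y by metis
  next
    assume a: "y \<in> generate G {x} \<and> ord y = ord x"
    then have "x \<in> generate G {y}"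
      using in_generate_if_ord_dvd[OF fin x self_in_generate, of y] by simp
    then show "generate G {y} = generate G {x}"
      using a generate_singleton_mono x y by blast
  qed
  then have "{y \<in> carrier G. generate G {y} = generate G {x}} =
      {y \<in> carrier G. y \<in> generate G {x} \<and> ord y = ord x}" by blast
  then show ?thesis
    using card_generate_ord_eq[OF fin x dvd_refl] generate_pow_card[OF x] by simp
qed

lemma (in group) generate_subset_iff:
  assumes "y \<in> carrier G"
  shows "generate G {x} \<subseteq> generate G {y} \<longleftrightarrow> x \<in> generate G {y}"
  using generate_singleton_mono[OF _ assms] self_in_generate by blast

theorem theorem2p19:
  fixes G\<^sub>1 :: "('a, 'm) monoid_scheme" and G\<^sub>2 :: "('b, 'n) monoid_scheme"
  assumes "group G\<^sub>1" and "finite (carrier G\<^sub>1)"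
    and "group G\<^sub>2" and "finite (carrier G\<^sub>2)"
  shows "digraph_iso (with_proj (power_graph G\<^sub>1)) (with_proj (power_graph G\<^sub>2)) \<longleftrightarrow>
    (\<exists>\<sigma>. poset_isomorphism (cyclic_subgroups G\<^sub>1) (cyclic_subgroups G\<^sub>2) \<sigma> \<and>
         (\<forall>C\<in>cyclic_subgroups G\<^sub>1. card (\<sigma> C) = card C))"
  unfolding digraph_iso_power_graph_iff[OF assms(1-3)]
proof
  interpret G\<^sub>1: group G\<^sub>1 by fact
  interpret G\<^sub>2: group G\<^sub>2 by fact
  let ?V\<^sub>1 = "carrier G\<^sub>1" and ?V\<^sub>2 = "carrier G\<^sub>2"
  let ?g\<^sub>1 = "\<lambda>x. generate G\<^sub>1 {x}" and ?g\<^sub>2 = "\<lambda>y. generate G\<^sub>2 {y}"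
  {
    assume "\<exists>f. bij_betw f ?V\<^sub>1 ?V\<^sub>2 \<and> (\<forall>x\<in>?V\<^sub>1. \<forall>y\<in>?V\<^sub>1.
      x \<in> ?g\<^sub>1 y \<or> y \<in> ?g\<^sub>1 x \<longleftrightarrow> f x \<in> ?g\<^sub>2 (f y) \<or> f y \<in> ?g\<^sub>2 (f x))"
    then obtain f where f: "bij_betw f ?V\<^sub>1 ?V\<^sub>2"
      "\<And>x y. x \<in> ?V\<^sub>1 \<Longrightarrow> y \<in> ?V\<^sub>1 \<Longrightarrow>
        x \<in> ?g\<^sub>1 y \<or> y \<in> ?g\<^sub>1 x \<longleftrightarrow> f x \<in> ?g\<^sub>2 (f y) \<or> f y \<in> ?g\<^sub>2 (f x)"
      by blast
    interpret cyclic_preorder_graph_iso ?V\<^sub>1 "\<lambda>x y. x \<in> ?g\<^sub>1 y" G\<^sub>1.ord ?V\<^sub>2 "\<lambda>x y. x \<in> ?g\<^sub>2 y" G\<^sub>2.ord f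
      using G\<^sub>1.cyclic_preorder_generate[OF assms(2)] G\<^sub>2.cyclic_preorder_generate[OF assms(4)] f
      by (intro cyclic_preorder_graph_iso.intro cyclic_preorder_graph_iso_axioms.intro)
    obtain F where F: "bij_betw F ?V\<^sub>1 ?V\<^sub>2"
      and le: "\<And>x y. x \<in> ?V\<^sub>1 \<Longrightarrow> y \<in> ?V\<^sub>1 \<Longrightarrow> x \<in> ?g\<^sub>1 y \<longleftrightarrow> F x \<in> ?g\<^sub>2 (F y)"
      using le_preserving_bij by blast
    have inj: "inj_on F ?V\<^sub>1" and im: "F ` ?V\<^sub>1 = ?V\<^sub>2" using F by (auto simp: bij_betw_def)
    \<comment> \<open>\<open>F\<close> preserves the preorder in both directions, so it maps
      down-sets, which are the cyclic subgroups, onto down-sets. Direct image under \<open>F\<close>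
      thus serves as \<open>\<sigma>\<close>, and injectivity keeps cardinalities.\<close>
    have image_generate: "F ` ?g\<^sub>1 x = ?g\<^sub>2 (F x)" if x: "x \<in> ?V\<^sub>1" for x
    proof -
      have Fx: "F x \<in> ?V\<^sub>2" using im x by blast
      show ?thesis
      proof
        show "F ` ?g\<^sub>1 x \<subseteq> ?g\<^sub>2 (F x)" using le[OF _ x] G\<^sub>1.generate_singleton_carrier[OF x] by blast
        show "?g\<^sub>2 (F x) \<subseteq> F ` ?g\<^sub>1 x"
        proof
          fix v assume v: "v \<in> ?g\<^sub>2 (F x)"
          then have "v \<in> F ` ?V\<^sub>1" unfolding im using G\<^sub>2.generate_singleton_carrier[OF Fx] by blast
          then obtain u where "u \<in> ?V\<^sub>1" "v = F u" by blast
          then show "v \<in> F ` ?g\<^sub>1 x" using v le[OF _ x] by simp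
        qed
      qed
    qed
    have sub: "C \<subseteq> ?V\<^sub>1" if "C \<in> cyclic_subgroups G\<^sub>1" for C
      using that G\<^sub>1.generate_singleton_carrier unfolding G\<^sub>1.cyclic_subgroups_eq by blast
    have "(`) F ` cyclic_subgroups G\<^sub>1 = cyclic_subgroups G\<^sub>2"
      unfolding G\<^sub>1.cyclic_subgroups_eq G\<^sub>2.cyclic_subgroups_eq im[symmetric] image_image
      by (rule image_cong) (simp_all add: image_generate)
    moreover have "inj_on ((`) F) (cyclic_subgroups G\<^sub>1)"
      by (rule inj_on_subset[OF inj_on_image_Pow[OF inj]]) (use sub in blast)
    moreover have "A \<subseteq> B \<longleftrightarrow> F ` A \<subseteq> F ` B"
      if AB: "A \<in> cyclic_subgroups G\<^sub>1" "B \<in> cyclic_subgroups G\<^sub>1" for A B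
    proof
      assume FAB: "F ` A \<subseteq> F ` B"
      show "A \<subseteq> B"
      proof
        fix a assume "a \<in> A"
        then have "F a \<in> F ` B" "a \<in> ?V\<^sub>1" using FAB sub[OF AB(1)] by auto
        then show "a \<in> B" using inj_on_image_mem_iff[OF inj _ sub[OF AB(2)]] by blast
      qed
    qed (rule image_mono)
    moreover have "card (F ` C) = card C" if "C \<in> cyclic_subgroups G\<^sub>1" for C
      using card_image[OF inj_on_subset[OF inj sub[OF that]]] .
    ultimately show "\<exists>\<sigma>. poset_isomorphism (cyclic_subgroups G\<^sub>1) (cyclic_subgroups G\<^sub>2) \<sigma> \<and>
        (\<forall>C\<in>cyclic_subgroups G\<^sub>1. card (\<sigma> C) = card C)"
      unfolding poset_isomorphism_def bij_betw_def by (intro exI[of _ "(`) F"]) simp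
  }
  assume "\<exists>\<sigma>. poset_isomorphism (cyclic_subgroups G\<^sub>1) (cyclic_subgroups G\<^sub>2) \<sigma> \<and>
      (\<forall>C\<in>cyclic_subgroups G\<^sub>1. card (\<sigma> C) = card C)"
  then obtain \<sigma> where iso: "poset_isomorphism (cyclic_subgroups G\<^sub>1) (cyclic_subgroups G\<^sub>2) \<sigma>"
    and card: "\<forall>C\<in>cyclic_subgroups G\<^sub>1. card (\<sigma> C) = card C"
    by blast
  have inj: "inj_on \<sigma> (cyclic_subgroups G\<^sub>1)"
    and im: "\<sigma> ` cyclic_subgroups G\<^sub>1 = cyclic_subgroups G\<^sub>2"
    using iso by (simp_all add: poset_isomorphism_def bij_betw_def)
  have mono: "A \<subseteq> B \<longleftrightarrow> \<sigma> A \<subseteq> \<sigma> B"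
    if "A \<in> cyclic_subgroups G\<^sub>1" "B \<in> cyclic_subgroups G\<^sub>1" for A B
    using iso that by (simp add: poset_isomorphism_def)
  have cyc: "?g\<^sub>1 x \<in> cyclic_subgroups G\<^sub>1" if "x \<in> ?V\<^sub>1" for x
    unfolding G\<^sub>1.cyclic_subgroups_eq using that by blast
  \<comment> \<open>Elements are labelled by a cyclic subgroup of \<open>G\<^sub>2\<close>. Both
    fibres over \<open>K\<close> consist of all generators of one cyclic subgroup, and the two
    subgroups have equal size.\<close>
  have "card {x \<in> ?V\<^sub>1. \<sigma> (?g\<^sub>1 x) = K} = card {y \<in> ?V\<^sub>2. ?g\<^sub>2 y = K}" for K
  proof (cases "K \<in> cyclic_subgroups G\<^sub>2")
    case True
    then obtain x\<^sub>0 where x\<^sub>0: "x\<^sub>0 \<in> ?V\<^sub>1" "K = \<sigma> (?g\<^sub>1 x\<^sub>0)"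
      unfolding im[symmetric] G\<^sub>1.cyclic_subgroups_eq by blast
    obtain y\<^sub>0 where y\<^sub>0: "y\<^sub>0 \<in> ?V\<^sub>2" "K = ?g\<^sub>2 y\<^sub>0"
      using True unfolding G\<^sub>2.cyclic_subgroups_eq by blast
    have "{x \<in> ?V\<^sub>1. \<sigma> (?g\<^sub>1 x) = K} = {x \<in> ?V\<^sub>1. ?g\<^sub>1 x = ?g\<^sub>1 x\<^sub>0}"
      using inj_on_eq_iff[OF inj cyc cyc[OF x\<^sub>0(1)]] x\<^sub>0(2) by blast
    then have "card {x \<in> ?V\<^sub>1. \<sigma> (?g\<^sub>1 x) = K} = totient (card (?g\<^sub>1 x\<^sub>0))"
      using G\<^sub>1.card_same_generate[OF assms(2) x\<^sub>0(1)] by simp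
    also have "\<dots> = totient (card (?g\<^sub>2 y\<^sub>0))"
      using bspec[OF card cyc[OF x\<^sub>0(1)]] x\<^sub>0(2) y\<^sub>0(2) by simp
    also have "\<dots> = card {y \<in> ?V\<^sub>2. ?g\<^sub>2 y = K}"
      using G\<^sub>2.card_same_generate[OF assms(4) y\<^sub>0(1)] y\<^sub>0(2) by simp
    finally show ?thesis .
  next
    case False
    have "{x \<in> ?V\<^sub>1. \<sigma> (?g\<^sub>1 x) = K} = {}" using False cyc im by blast
    moreover have "{y \<in> ?V\<^sub>2. ?g\<^sub>2 y = K} = {}" using False G\<^sub>2.cyclic_subgroups_eq by blast
    ultimately show ?thesis by (simp only: card.empty)
  qed
  then obtain F where F: "bij_betw F ?V\<^sub>1 ?V\<^sub>2" "\<And>x. x \<in> ?V\<^sub>1 \<Longrightarrow> ?g\<^sub>2 (F x) = \<sigma> (?g\<^sub>1 x)"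
    using bij_betw_if_card_fibres_eq[OF assms(2,4), of "\<lambda>x. \<sigma> (?g\<^sub>1 x)" ?g\<^sub>2] by blast
  have le: "x \<in> ?g\<^sub>1 y \<longleftrightarrow> F x \<in> ?g\<^sub>2 (F y)" if xy: "x \<in> ?V\<^sub>1" "y \<in> ?V\<^sub>1" for x y
  proof -
    have Fy: "F y \<in> ?V\<^sub>2" using F(1) xy(2) bij_betwE by blast
    have "x \<in> ?g\<^sub>1 y \<longleftrightarrow> ?g\<^sub>1 x \<subseteq> ?g\<^sub>1 y" using G\<^sub>1.generate_subset_iff[OF xy(2)] by simp
    also have "\<dots> \<longleftrightarrow> ?g\<^sub>2 (F x) \<subseteq> ?g\<^sub>2 (F y)"
      using mono[OF cyc cyc, OF xy] F(2) xy by simp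
    also have "\<dots> \<longleftrightarrow> F x \<in> ?g\<^sub>2 (F y)" using G\<^sub>2.generate_subset_iff[OF Fy] .
    finally show ?thesis .
  qed
  show "\<exists>f. bij_betw f ?V\<^sub>1 ?V\<^sub>2 \<and> (\<forall>x\<in>?V\<^sub>1. \<forall>y\<in>?V\<^sub>1.
      x \<in> ?g\<^sub>1 y \<or> y \<in> ?g\<^sub>1 x \<longleftrightarrow> f x \<in> ?g\<^sub>2 (f y) \<or> f y \<in> ?g\<^sub>2 (f x))"
    using F(1) le by (intro exI[of _ F]) simp
qed

end
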